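(* Let $k$ be an algebraically closed field of characteristic zero, $R=k[x_0,x_1,\dots,x_n]$, and let $I\subset R$ be an artinian ideal generated by $r$ linearly independent homogeneous polynomials $F_1,\dots,F_r$ of degree $d$. If $r\le \binom{n+d-1}{n-1}$, then the following conditions are equivalent: (1) the ideal $I$ fails the Weak Lefschetz Property in degree $d-1$; (2) the homogeneous forms $F_1,\dots,F_r$ become $k$-linearly dependent when restricted to a general hyperplane $H$ of $\mathbb{P}^n$; (3) the $n$-dimensional variety $X_{n,(I^{-1})_d}\subset\mathbb{P}^{\binom{n+d}{d}-r-1}$ satisfies at least one Laplace equation of order $d-1$.
   Context: Failing WLP in degree $j$: for a homogeneous artinian ideal $I\subset R$ and an integer $j$, $I$ fails the Weak Lefschetz Property in degree $j$ if for a general linear form $L$ the multiplication map $\times L:(R/I)_j\to(R/I)_{j+1}$ does not have maximal rank, i.e. is neither injective nor surjective. Inverse system: let $\mathcal{R}=k[y_0,\dots,y_n]$, with $R$ acting on $\mathcal{R}$ by partial differentiation, $u\cdot F=u(\partial/\partial y_0,\dots,\partial/\partial y_n)F$. The Macaulay inverse system of $I$ is $I^{-1}=\{F\in\mathcal{R}: u\cdot F=0 \text{ for all } u\in I\}$, a graded $R$-submodule of $\mathcal{R}$; $(I^{-1})_d$ is its degree $d$ part, of dimension $\binom{n+d}{d}-r$. The variety: a basis $G_0,\dots,G_N$ of $(I^{-1})_d$, with $N=\binom{n+d}{d}-r-1$, defines a rational map $\varphi_{(I^{-1})_d}=(G_0:\dots:G_N):\mathbb{P}^n\dashrightarrow\mathbb{P}^N$;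 $X_{n,(I^{-1})_d}$ denotes the closure of its image (the projection of the Veronese variety $V(n,d)$, i.e. the image of $\mathbb{P}^n$ in the $d$-tuple Veronese embedding $\mathbb{P}^n\to\mathbb{P}^{\binom{n+d}{d}-1}$, from the linear space $\langle F_1,\dots,F_r\rangle$). Laplace equations: for an $n$-dimensional variety $X\subset\mathbb{P}^N$ with local parametrization $\phi(t_1,\dots,t_n)$ at a smooth point, the $s$-th osculating space there is the span of all partial derivatives of $\phi$ of order $\le s$; as a projective subspace of $\mathbb{P}^N$ its expected dimension is $\binom{n+s}{s}-1$. $X$ satisfies $\delta$ (independent) Laplace equations of order $s$ if at a general point the projective $s$-th osculating space has dimension $\binom{n+s}{s}-1-\delta$. For $X=X_{n,(I^{-1})_d}$, parametrized by the rational map $\varphi_{(I^{-1})_d}=(G_0:\dots:G_N):\mathbb{P}^n\dashrightarrow\mathbb{P}^N$ whose components $G_0,\dots,G_N$ are forms of degree $d\ge s$ forming a basis of $(I^{-1})_d$, the osculating space is computed from this parametrization: by Euler's formula, the projective $s$-th osculating space at the image of a general point $x\in\mathbb{P}^n$ is the projective subspace spanned by all the vectors $\big(\partial^\alpha G_0(x),\dots,\partial^\alpha G_N(x)\big)$ with $|\alpha|=s$. *)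

theory Defs
  imports
    "HOL-Library.Poly_Mapping"
    "HOL-Library.Function_Algebras"
    "HOL-Library.Cardinality"
    "HOL-Computational_Algebra.Polynomial"
begin

section \<open>Polynomials\<close>

text \<open>
  Polynomials with variables indexed by the type \<open>'v\<close>: finitely supported functions from exponent
  vectors to coefficients, with the convolution product of \<open>HOL-Library.Poly_Mapping\<close>.
  For finite \<open>'v\<close> with \<open>n + 1\<close> elements this is the polynomial ring in \<open>n + 1\<close> variables. The same
  type is used for the ring $R$ and for the ring on which $R$ acts by differentiation.
\<close>

type_synonym ('v, 'a) mpoly = "('v \<Rightarrow>\<^sub>0 nat) \<Rightarrow>\<^sub>0 'a"

definition Const :: "'a \<Rightarrow> ('v, 'a::field) mpoly" where
  "Const c = Poly_Mapping.single 0 c"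

definition Var :: "'v \<Rightarrow> ('v, 'a::field) mpoly" where
  "Var v = Poly_Mapping.single (Poly_Mapping.single v 1) 1"

definition scale_mpoly :: "'a \<Rightarrow> ('v, 'a::field) mpoly \<Rightarrow> ('v, 'a) mpoly" where
  "scale_mpoly c p = Const c * p"

definition mdeg :: "('v::finite \<Rightarrow>\<^sub>0 nat) \<Rightarrow> nat" where
  "mdeg m = (\<Sum>v\<in>UNIV. Poly_Mapping.lookup m v)"

definition eval :: "('v::finite \<Rightarrow> 'a) \<Rightarrow> ('v, 'a::field) mpoly \<Rightarrow> 'a" where
  "eval x p = (\<Sum>m\<in>Poly_Mapping.keys p.
     Poly_Mapping.lookup p m * (\<Prod>v\<in>UNIV. x v ^ Poly_Mapping.lookup m v))"

text \<open>The graded piece of degree \<open>j\<close>; it contains 0.\<close>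

definition forms :: "nat \<Rightarrow> ('v::finite, 'a::field) mpoly set" where
  "forms j = {p. \<forall>m\<in>Poly_Mapping.keys p. mdeg m = j}"

definition linear_form :: "('v::finite \<Rightarrow> 'a) \<Rightarrow> ('v, 'a::field) mpoly" where
  "linear_form a = (\<Sum>v\<in>UNIV. scale_mpoly (a v) (Var v))"

section \<open>Linear algebra and ideals\<close>

text \<open>Scalar multiplication on spaces of functions with values in the field.\<close>

definition fscale :: "'a::field \<Rightarrow> ('b \<Rightarrow> 'a) \<Rightarrow> 'b \<Rightarrow> 'a" where
  "fscale c f = (\<lambda>x. c * f x)"

interpretation mpoly_module: module "(*) :: ('v, 'a::field) mpoly \<Rightarrow> _ \<Rightarrow> _"
  by standard (simp_all add: algebra_simps)

interpretation mpoly_space: vector_space "scale_mpoly :: 'a::field \<Rightarrow> ('v, 'a) mpoly \<Rightarrow> _"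
proof
  fix a b :: 'a and x :: "('v, 'a) mpoly"
  show "scale_mpoly (a + b) x = scale_mpoly a x + scale_mpoly b x"
    by (simp add: scale_mpoly_def Const_def single_add distrib_right)
  show "scale_mpoly a (scale_mpoly b x) = scale_mpoly (a * b) x"
    by (simp add: scale_mpoly_def Const_def mult_single flip: mult.assoc)
  show "scale_mpoly 1 x = x"
    by (simp add: scale_mpoly_def Const_def)
qed (simp add: scale_mpoly_def distrib_left)

interpretation fun_space: vector_space "fscale :: 'a::field \<Rightarrow> ('b \<Rightarrow> 'a) \<Rightarrow> _"
  by standard (auto simp: fscale_def fun_eq_iff algebra_simps)

text \<open>
  Linear independence of an indexed family over a finite index set. In contrast to independence of
  the set of its members, this fails if two members coincide.
\<close>

definition lin_indep_family ::
    "('a::field \<Rightarrow> 'b::ab_group_add \<Rightarrow> 'b) \<Rightarrow> 'i set \<Rightarrow> ('i \<Rightarrow> 'b) \<Rightarrow> bool" where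
  "lin_indep_family scale A v \<longleftrightarrow>
     (\<forall>c. (\<Sum>i\<in>A. scale (c i) (v i)) = 0 \<longrightarrow> (\<forall>i\<in>A. c i = 0))"

definition is_basis_family :: "'i set \<Rightarrow> ('i \<Rightarrow> ('v, 'a::field) mpoly) \<Rightarrow> ('v, 'a) mpoly set \<Rightarrow> bool" where
  "is_basis_family A v W \<longleftrightarrow> lin_indep_family scale_mpoly A v \<and> module.span scale_mpoly (v ` A) = W"

text \<open>Ideals are the submodules of the ring, regarded as a module over itself.\<close>

definition is_ideal :: "('v, 'a::field) mpoly set \<Rightarrow> bool" where
  "is_ideal J \<longleftrightarrow> module.subspace (*) J"

definition ideal_generated :: "('v, 'a::field) mpoly set \<Rightarrow> ('v, 'a) mpoly set" where
  "ideal_generated S = module.span (*) S"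

text \<open>
  The quotient $R/I$ is an artinian ring: descending chains of ideals of $R/I$, i.e. of ideals of
  $R$ containing $I$, become stationary.
\<close>

definition artinian_ideal :: "('v, 'a::field) mpoly set \<Rightarrow> bool" where
  "artinian_ideal I \<longleftrightarrow> is_ideal I \<and>
     (\<forall>J :: nat \<Rightarrow> ('v, 'a) mpoly set.
        (\<forall>k. is_ideal (J k) \<and> I \<subseteq> J k \<and> J (Suc k) \<subseteq> J k) \<longrightarrow> (\<exists>k. \<forall>l\<ge>k. J l = J k))"

section \<open>General points\<close>

text \<open>
  Points of projective space are given by nonzero vectors of homogeneous coordinates. A Zariski
  open set (as a set of such vectors) is the complement of the common zero locus of a set of
  homogeneous polynomials. A property holds for a general point if it holds on a nonempty open set.
  General linear forms and general hyperplanes are general points of the dual projective space.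
\<close>

definition zariski_open :: "('v::finite \<Rightarrow> 'a::field) set \<Rightarrow> bool" where
  "zariski_open U \<longleftrightarrow>
     (\<exists>S \<subseteq> (\<Union>e. forms e). U = {x. x \<noteq> 0 \<and> (\<exists>f\<in>S. eval x f \<noteq> 0)})"

definition for_general :: "(('v::finite \<Rightarrow> 'a::field) \<Rightarrow> bool) \<Rightarrow> bool" where
  "for_general P \<longleftrightarrow> (\<exists>U. zariski_open U \<and> U \<noteq> {} \<and> (\<forall>x\<in>U. P x))"

section \<open>The weak Lefschetz property\<close>

definition residue_class :: "('v, 'a::field) mpoly set \<Rightarrow> ('v, 'a) mpoly \<Rightarrow> ('v, 'a) mpoly set" where
  "residue_class I f = {g. g - f \<in> I}"

definition quotient_part :: "('v::finite, 'a::field) mpoly set \<Rightarrow> nat \<Rightarrow> ('v, 'a) mpoly set set" where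
  "quotient_part I j = residue_class I ` forms j"

text \<open>Multiplication by \<open>L\<close> on residue classes: the class of \<open>f\<close> is mapped to the class of \<open>L * f\<close>.\<close>

definition mult_class ::
    "('v, 'a::field) mpoly set \<Rightarrow> ('v, 'a) mpoly \<Rightarrow> ('v, 'a) mpoly set \<Rightarrow> ('v, 'a) mpoly set" where
  "mult_class I L C = (\<Union>f\<in>C. residue_class I (L * f))"

definition fails_WLP :: "('v::finite, 'a::field) mpoly set \<Rightarrow> nat \<Rightarrow> bool" where
  "fails_WLP I j \<longleftrightarrow> for_general (\<lambda>a.
     \<not> inj_on (mult_class I (linear_form a)) (quotient_part I j) \<and>
     mult_class I (linear_form a) ` quotient_part I j \<noteq> quotient_part I (j + 1))"

lemma mult_class_residue_class:
  assumes "is_ideal I"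
  shows "mult_class I L (residue_class I f) = residue_class I (L * f)"
proof -
  have sub: "mpoly_module.subspace I"
    using assms by (simp add: is_ideal_def)
  have "g - L * f \<in> I" if "h - f \<in> I" "g - L * h \<in> I" for g h
  proof -
    have "L * (h - f) \<in> I"
      using mpoly_module.subspace_scale[OF sub that(1)] .
    then have "(g - L * h) + L * (h - f) \<in> I"
      using mpoly_module.subspace_add[OF sub that(2)] by blast
    then show ?thesis by (simp add: algebra_simps)
  qed
  moreover have "f - f \<in> I"
    using mpoly_module.subspace_0[OF sub] by simp
  ultimately show ?thesis
    unfolding mult_class_def residue_class_def by blast
qed

section \<open>Restriction to a hyperplane\<close>

text \<open>The affine cone over the hyperplane with equation \<open>linear_form a\<close>.\<close>

definition hyperplane :: "('v::finite \<Rightarrow> 'a::field) \<Rightarrow> ('v \<Rightarrow> 'a) set" where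
  "hyperplane a = {x. eval x (linear_form a) = 0}"

text \<open>
  The polynomial function of \<open>f\<close> restricted to \<open>H\<close>. Outside \<open>H\<close> its value is set to 0, so that the
  functions on \<open>H\<close> form a subspace of the space of all functions.
\<close>

definition restriction :: "('v::finite \<Rightarrow> 'a) set \<Rightarrow> ('v, 'a::field) mpoly \<Rightarrow> ('v \<Rightarrow> 'a) \<Rightarrow> 'a" where
  "restriction H f = (\<lambda>x. if x \<in> H then eval x f else 0)"

definition dependent_on_general_hyperplane ::
    "'i set \<Rightarrow> ('i \<Rightarrow> ('v::finite, 'a::field) mpoly) \<Rightarrow> bool" where
  "dependent_on_general_hyperplane A F \<longleftrightarrow>
     for_general (\<lambda>a. \<not> lin_indep_family fscale A (\<lambda>i. restriction (hyperplane a) (F i)))"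

section \<open>Differentiation and the Macaulay inverse system\<close>

definition pdiff :: "'v \<Rightarrow> ('v, 'a::field) mpoly \<Rightarrow> ('v, 'a) mpoly" where
  "pdiff v p = (\<Sum>m\<in>Poly_Mapping.keys p.
     Poly_Mapping.single (m - Poly_Mapping.single v 1)
       (of_nat (Poly_Mapping.lookup m v) * Poly_Mapping.lookup p m))"

text \<open>
  The iterated derivative \<open>\<partial>\<^sup>\<alpha>\<close>. The fold is independent of the order of the variables,
  because partial derivatives commute (see below).
\<close>

definition pdiffs :: "('v::finite \<Rightarrow>\<^sub>0 nat) \<Rightarrow> ('v, 'a::field) mpoly \<Rightarrow> ('v, 'a) mpoly" where
  "pdiffs \<alpha> p = Finite_Set.fold (\<lambda>v. pdiff v ^^ Poly_Mapping.lookup \<alpha> v) p UNIV"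

lemma lookup_pdiff:
  "Poly_Mapping.lookup (pdiff v p) m =
     of_nat (Poly_Mapping.lookup m v + 1) * Poly_Mapping.lookup p (m + Poly_Mapping.single v 1)"
proof -
  let ?e = "Poly_Mapping.single v (1::nat)"
  have eq: "Poly_Mapping.lookup (Poly_Mapping.single (k - ?e)
          (of_nat (Poly_Mapping.lookup k v) * Poly_Mapping.lookup p k)) m =
        (if k = m + ?e then of_nat (Poly_Mapping.lookup m v + 1) * Poly_Mapping.lookup p k else 0)" for k
  proof (cases "Poly_Mapping.lookup k v = 0")
    case True
    moreover from this have "k \<noteq> m + ?e"
      by (auto simp: lookup_add)
    ultimately show ?thesis by simp
  next
    case False
    then have "k - ?e + ?e = k"
      by (intro poly_mapping_eqI) (auto simp: lookup_add lookup_minus lookup_single when_def)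
    then have "k - ?e = m \<longleftrightarrow> k = m + ?e"
      by (metis add_diff_cancel_right')
    then show ?thesis
      by (auto simp: lookup_single when_def lookup_add)
  qed
  have "Poly_Mapping.lookup (pdiff v p) m = (\<Sum>k\<in>Poly_Mapping.keys p.
      if k = m + ?e then of_nat (Poly_Mapping.lookup m v + 1) * Poly_Mapping.lookup p k else 0)"
    unfolding pdiff_def lookup_sum eq ..
  then show ?thesis
    by (simp add: sum.delta in_keys_iff)
qed

lemma pdiff_commute: "pdiff v (pdiff w p) = pdiff w (pdiff v p)"
  by (cases "v = w")
    (auto intro!: poly_mapping_eqI simp: lookup_pdiff lookup_add lookup_single when_def ac_simps)

lemma pdiffs_comp_fun_commute:
  "comp_fun_commute (\<lambda>v. pdiff v ^^ Poly_Mapping.lookup \<alpha> v :: ('v, 'a::field) mpoly \<Rightarrow> _)"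
proof
  fix v w :: 'v
  have *: "(pdiff v ^^ k) (pdiff w p) = pdiff w ((pdiff v ^^ k) p)" for k and p :: "('v, 'a) mpoly"
    by (induction k) (simp_all add: pdiff_commute)
  have "(pdiff v ^^ k) ((pdiff w ^^ l) p) = (pdiff w ^^ l) ((pdiff v ^^ k) p)"
    for k l and p :: "('v, 'a) mpoly"
    by (induction l) (simp_all add: *)
  then show "(pdiff w ^^ Poly_Mapping.lookup \<alpha> w) \<circ> (pdiff v ^^ Poly_Mapping.lookup \<alpha> v) =
      (pdiff v ^^ Poly_Mapping.lookup \<alpha> v) \<circ> (pdiff w ^^ Poly_Mapping.lookup \<alpha> w :: ('v, 'a) mpoly \<Rightarrow> _)"
    by (simp add: fun_eq_iff)
qed

text \<open>The action \<open>u \<cdot> F = u(\<partial>/\<partial>y\<^sub>0, \<dots>, \<partial>/\<partial>y\<^sub>n) F\<close>.\<close>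

definition diff_action :: "('v::finite, 'a::field) mpoly \<Rightarrow> ('v, 'a) mpoly \<Rightarrow> ('v, 'a) mpoly" where
  "diff_action u F =
     (\<Sum>\<alpha>\<in>Poly_Mapping.keys u. scale_mpoly (Poly_Mapping.lookup u \<alpha>) (pdiffs \<alpha> F))"

definition inverse_system :: "('v::finite, 'a::field) mpoly set \<Rightarrow> ('v, 'a) mpoly set" where
  "inverse_system I = {F. \<forall>u\<in>I. diff_action u F = 0}"

section \<open>Laplace equations\<close>

text \<open>
  Let \<open>G\<^sub>0, \<dots>, G\<^sub>N\<close> be forms of the same degree $d \ge s$ and let $X$ be the closure of the image of
  the rational map \<open>x \<mapsto> (G\<^sub>0(x) : \<dots> : G\<^sub>N(x))\<close>. By Euler's formula, the vectors of partial
  derivatives of order exactly \<open>s\<close> with respect to the homogeneous coordinates span the affine cone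
  over the \<open>s\<close>-th osculating space of $X$ at the image of a general point \<open>x\<close>.
  Vectors of length \<open>N + 1\<close> are functions on \<open>nat\<close> vanishing beyond \<open>N\<close>.
\<close>

definition derivative_vector ::
    "nat \<Rightarrow> (nat \<Rightarrow> ('v::finite, 'a::field) mpoly) \<Rightarrow> ('v \<Rightarrow>\<^sub>0 nat) \<Rightarrow> ('v \<Rightarrow> 'a) \<Rightarrow> nat \<Rightarrow> 'a" where
  "derivative_vector N G \<alpha> x = (\<lambda>i. if i \<le> N then eval x (pdiffs \<alpha> (G i)) else 0)"

definition osculating_cone ::
    "nat \<Rightarrow> (nat \<Rightarrow> ('v::finite, 'a::field) mpoly) \<Rightarrow> nat \<Rightarrow> ('v \<Rightarrow> 'a) \<Rightarrow> (nat \<Rightarrow> 'a) set" where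
  "osculating_cone N G s x = module.span fscale {derivative_vector N G \<alpha> x | \<alpha>. mdeg \<alpha> = s}"

definition osculating_dim ::
    "nat \<Rightarrow> (nat \<Rightarrow> ('v::finite, 'a::field) mpoly) \<Rightarrow> nat \<Rightarrow> ('v \<Rightarrow> 'a) \<Rightarrow> int" where
  "osculating_dim N G s x = int (vector_space.dim fscale (osculating_cone N G s x)) - 1"

text \<open>The source of the parametrization is the projective space of dimension \<open>n = CARD('v) - 1\<close>.\<close>

definition satisfies_Laplace_equations ::
    "nat \<Rightarrow> (nat \<Rightarrow> ('v::finite, 'a::field) mpoly) \<Rightarrow> nat \<Rightarrow> nat \<Rightarrow> bool" where
  "satisfies_Laplace_equations N G s \<delta> \<longleftrightarrow>
     for_general (\<lambda>x :: 'v \<Rightarrow> 'a.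
       osculating_dim N G s x = int ((CARD('v) - 1 + s) choose s) - 1 - int \<delta>)"

end

theory Submission
  imports Defs
begin

text \<open>
  Let \<open>K(a)\<close> be the space of all forms \<open>f\<close> of degree \<open>d - 1\<close> such that \<open>\<ell>\<^sub>a f\<close> lies in the span of
  the \<open>F\<^sub>i\<close>, where \<open>\<ell>\<^sub>a\<close> is the linear form with coefficient vector \<open>a\<close>. For every single \<open>a \<noteq> 0\<close>,
  each of the following says that \<open>K(a) \<noteq> 0\<close>. Multiplication by \<open>\<ell>\<^sub>a\<close> is not injective in degree
  \<open>d - 1\<close>; by the bound on \<open>r\<close> and a dimension count it is then not surjective either. The \<open>F\<^sub>i\<close>
  become dependent on the hyperplane \<open>\<ell>\<^sub>a = 0\<close>, because a form vanishing there is divisible by \<open>\<ell>\<^sub>a\<close>.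
  The derivative vectors of order \<open>d - 1\<close> at the point \<open>a\<close> are dependent: evaluating a linear form at
  \<open>a\<close> is letting \<open>\<ell>\<^sub>a\<close> act on it, so a relation with coefficients \<open>c\<^sub>\<alpha>\<close> says that
  \<open>\<ell>\<^sub>a \<Sum> c\<^sub>\<alpha> x\<^sup>\<alpha>\<close> annihilates the inverse system in degree \<open>d\<close>, i.e. lies in the span of the \<open>F\<^sub>i\<close>.
  It remains to see that the dimension of the osculating space is constant on a nonempty open set.
\<close>

section \<open>Linear algebra\<close>

context vector_space
begin

lemma in_span_family_iff:
  assumes "finite A"
  shows "x \<in> span (v ` A) \<longleftrightarrow> (\<exists>c. x = (\<Sum>i\<in>A. scale (c i) (v i)))"
proof
  assume "x \<in> span (v ` A)"
  then show "\<exists>c. x = (\<Sum>i\<in>A. scale (c i) (v i))"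
  proof (induction rule: span_induct_alt)
    case base
    show ?case by (intro exI[of _ "\<lambda>_. 0"]) simp
  next
    case (step b y z)
    then obtain j c where j: "j \<in> A" "y = v j" and z: "z = (\<Sum>i\<in>A. scale (c i) (v i))"
      by blast
    have "scale b y + z = (\<Sum>i\<in>A. scale (c i + (if i = j then b else 0)) (v i))"
      using assms j
      by (simp add: z scale_left_distrib sum.distrib if_distrib[of "\<lambda>a. scale a _"] sum.delta
          add.commute cong: if_cong)
    then show ?case by (intro exI)
  qed
next
  assume "\<exists>c. x = (\<Sum>i\<in>A. scale (c i) (v i))"
  then show "x \<in> span (v ` A)"
    by (auto intro!: span_sum span_scale intro: span_base)
qed

text \<open>Since \<open>c j\<close> is nonzero, the equation defining the sum can be solved for
  \<open>v j\<close>. The sum need not vanish: with sum 0 the lemma shows that a dependent family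
  has a redundant member, and with the sum equal to a multiple of a linear form it replaces one
  generator of the ideal by that multiple.\<close>

lemma family_exchange:
  assumes "finite A" and "j \<in> A" and "c j \<noteq> 0"
  shows "v j \<in> span (insert (\<Sum>i\<in>A. scale (c i) (v i)) (v ` (A - {j})))"
proof -
  let ?s = "\<Sum>i\<in>A. scale (c i) (v i)" and ?t = "\<Sum>i\<in>A - {j}. scale (c i) (v i)"
  have "?s = scale (c j) (v j) + ?t"
    using assms by (simp add: sum.remove)
  then have "v j = scale (inverse (c j)) (?s - ?t)"
    using assms by simp
  moreover have "?t \<in> span (insert ?s (v ` (A - {j})))"
    by (intro span_sum span_scale) (auto intro: span_base)
  moreover have "?s \<in> span (insert ?s (v ` (A - {j})))"
    by (auto intro!: span_base)
  ultimately show ?thesis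
    by (auto intro!: span_diff span_scale simp: scale_right_diff_distrib)
qed

lemma lin_indep_family_imp_independent:
  assumes "finite A" and "lin_indep_family scale A v"
  shows "inj_on v A \<and> independent (v ` A)"
proof
  show inj: "inj_on v A"
  proof (rule inj_onI, rule ccontr)
    fix i j assume ij: "i \<in> A" "j \<in> A" "v i = v j" "i \<noteq> j"
    \<comment> \<open>A repeated member would give the nontrivial relation
      \<open>v i - v j = 0\<close>.\<close>
    define c where "c = (\<lambda>k. if k = i then 1 else if k = j then -1 else (0::'a))"
    have "(\<Sum>k\<in>A. scale (c k) (v k)) = (\<Sum>k\<in>{i,j}. scale (c k) (v k))"
      using ij assms(1) by (intro sum.mono_neutral_right) (auto simp: c_def)
    also have "\<dots> = 0" using ij by (simp add: c_def)
    finally have "c i = 0" using assms(2) ij by (auto simp: lin_indep_family_def)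
    then show False by (simp add: c_def)
  qed
  show "independent (v ` A)"
  proof
    assume "dependent (v ` A)"
    then obtain u where u: "\<exists>w\<in>v ` A. u w \<noteq> 0" "(\<Sum>w\<in>v ` A. scale (u w) w) = 0"
      using assms(1) by (auto simp: dependent_finite)
    have "(\<Sum>i\<in>A. scale (u (v i)) (v i)) = 0"
      using u(2) by (simp add: sum.reindex[OF inj])
    then have "\<forall>i\<in>A. u (v i) = 0"
      using assms(2) unfolding lin_indep_family_def by (elim allE[of _ "\<lambda>i. u (v i)"]) auto
    then show False using u(1) by auto
  qed
qed

lemma independent_imp_lin_indep_family:
  assumes "finite A" and "inj_on v A" and "independent (v ` A)"
  shows "lin_indep_family scale A v"
  unfolding lin_indep_family_def
proof (intro allI impI)
  fix c assume 0: "(\<Sum>i\<in>A. scale (c i) (v i)) = 0"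
  define u where "u = (\<lambda>w. c (the_inv_into A v w))"
  have u: "u (v i) = c i" if "i \<in> A" for i
    using that assms(2) by (simp add: u_def the_inv_into_f_f)
  have "(\<Sum>w\<in>v ` A. scale (u w) w) = 0"
    using 0 u by (simp add: sum.reindex[OF assms(2)])
  then have "\<forall>w\<in>v ` A. u w = 0"
    using assms(1,3) by (auto simp: dependent_finite)
  then show "\<forall>i\<in>A. c i = 0" using u by auto
qed

lemma dim_span_family_le: "finite A \<Longrightarrow> dim (span (v ` A)) \<le> card A"
  using dim_le_card[of "v ` A" "v ` A"] card_image_le[of A v]
  by (simp add: span_superset)

text \<open>A member with nonzero coefficient in a relation lies in the span of the others, so a
  dependent family spans a space of dimension less than its number of indices.\<close>

lemma dim_span_family_eq_iff:
  assumes "finite A"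
  shows "dim (span (v ` A)) = card A \<longleftrightarrow> lin_indep_family scale A v"
proof
  assume "lin_indep_family scale A v"
  then show "dim (span (v ` A)) = card A"
    using lin_indep_family_imp_independent[OF assms] dim_span_eq_card_independent card_image
    by metis
next
  assume dim: "dim (span (v ` A)) = card A"
  show "lin_indep_family scale A v"
  proof (rule ccontr)
    assume "\<not> ?thesis"
    then obtain c j where c: "(\<Sum>i\<in>A. scale (c i) (v i)) = 0" "j \<in> A" "c j \<noteq> 0"
      by (auto simp: lin_indep_family_def)
    have "v j \<in> span (v ` (A - {j}))"
      using family_exchange[where A = A and v = v and c = c and j = j, OF assms c(2,3)] c(1) by simp
    moreover have "v i \<in> span (v ` (A - {j}))" if "i \<in> A" "i \<noteq> j" for i
      using that by (intro span_base) auto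
    ultimately have "v ` A \<subseteq> span (v ` (A - {j}))"
      by blast
    then have "dim (v ` A) \<le> card (v ` (A - {j}))"
      using assms by (intro dim_le_card) auto
    also have "\<dots> \<le> card (A - {j})" using assms by (intro card_image_le) auto
    also have "\<dots> < card A" using assms c(2) by (intro card_Diff1_less)
    finally show False using dim by simp
  qed
qed

lemma exists_subfamily_basis:
  assumes "finite A"
  obtains B where "B \<subseteq> A" "lin_indep_family scale B v" "card B = dim (span (v ` A))"
proof -
  obtain W where W: "W \<subseteq> v ` A" "independent W" "v ` A \<subseteq> span W" "card W = dim (v ` A)"
    using basis_exists by blast
  obtain B where B: "B \<subseteq> A" "inj_on v B" "v ` B = W"
    using W(1) by (metis subset_image_inj)
  have "lin_indep_family scale B v"
    using B W(2) finite_subset[OF B(1) assms] by (intro independent_imp_lin_indep_family) auto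
  moreover have "card B = dim (span (v ` A))"
    using B W(4) card_image by fastforce
  ultimately show ?thesis using that B(1) by blast
qed

text \<open>Gives the lower bound for the dimension of an osculating space once some derivative
  vectors are known to be independent.\<close>

lemma card_lin_indep_subfamily_le:
  assumes "finite A" and "B \<subseteq> A" and "lin_indep_family scale B v"
  shows "card B \<le> dim (span (v ` A))"
proof -
  have B: "inj_on v B" "independent (v ` B)"
    using lin_indep_family_imp_independent[OF finite_subset[OF assms(2,1)] assms(3)] by auto
  obtain W where W: "W \<subseteq> v ` A" "independent W" "v ` A \<subseteq> span W" "card W = dim (v ` A)"
    using basis_exists by blast
  have "finite W" using W(1) assms(1) finite_subset by blast
  moreover have "v ` B \<subseteq> span W" using W(3) assms(2) by auto
  ultimately have "card (v ` B) \<le> card W"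
    using independent_span_bound[OF _ B(2)] by blast
  then show ?thesis using W(4) B(1) by (simp add: card_image)
qed

end

lemma sum_fscale_apply: "(\<Sum>i\<in>A. fscale (c i) (v i)) x = (\<Sum>i\<in>A. c i * v i x)"
  by (induction A rule: infinite_finite_induct) (auto simp: fscale_def)

lemma lin_indep_family_fscale_iff:
  "lin_indep_family fscale A v \<longleftrightarrow>
    (\<forall>c. (\<forall>x. (\<Sum>i\<in>A. c i * v i x) = 0) \<longrightarrow> (\<forall>i\<in>A. c i = 0))"
  unfolding lin_indep_family_def fun_eq_iff sum_fscale_apply by simp

section \<open>Polynomials\<close>

lemma lookup_scale_mpoly [simp]:
  "Poly_Mapping.lookup (scale_mpoly c p) m = c * Poly_Mapping.lookup p m"
  by (simp add: scale_mpoly_def Const_def map.rep_eq when_def flip: mult_map_scale_conv_mult)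

lemma keys_scale_mpoly: "Poly_Mapping.keys (scale_mpoly c p) \<subseteq> Poly_Mapping.keys p"
  by (auto simp: in_keys_iff)

lemma mult_scale_mpoly_right: "p * scale_mpoly c q = scale_mpoly c (p * q)"
  by (simp add: scale_mpoly_def mult.left_commute)

lemma scale_mpoly_single: "scale_mpoly c (Poly_Mapping.single m b) = Poly_Mapping.single m (c * b)"
  by (simp add: scale_mpoly_def Const_def mult_single)

lemma mpoly_eq_sum_monomials:
  fixes p :: "('v, 'a::field) mpoly"
  shows "p = (\<Sum>m\<in>Poly_Mapping.keys p.
    scale_mpoly (Poly_Mapping.lookup p m) (Poly_Mapping.single m 1))"
  by (intro poly_mapping_eqI)
    (auto simp: lookup_sum lookup_single when_def in_keys_iff sum.delta if_distrib cong: if_cong)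

text \<open>The linear functional with value \<open>g m\<close> on the monomial \<open>m\<close>.
  Evaluation at a point and the apolarity pairing are both of this kind and inherit their linearity
  from here.\<close>

definition linear_ext :: "(('v \<Rightarrow>\<^sub>0 nat) \<Rightarrow> 'a) \<Rightarrow> ('v, 'a::field) mpoly \<Rightarrow> 'a" where
  "linear_ext g p = (\<Sum>m\<in>Poly_Mapping.keys p. Poly_Mapping.lookup p m * g m)"

lemma linear_ext_superset:
  assumes "finite S" and "Poly_Mapping.keys p \<subseteq> S"
  shows "linear_ext g p = (\<Sum>m\<in>S. Poly_Mapping.lookup p m * g m)"
  unfolding linear_ext_def
  using assms by (intro sum.mono_neutral_left) (auto simp: in_keys_iff)

lemma linear_ext_add: "linear_ext g (p + q) = linear_ext g p + linear_ext g q"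
proof -
  let ?S = "Poly_Mapping.keys p \<union> Poly_Mapping.keys q"
  have "linear_ext g (p + q) = (\<Sum>m\<in>?S. Poly_Mapping.lookup (p + q) m * g m)"
    using keys_add[of p q] by (intro linear_ext_superset) auto
  moreover have "linear_ext g p = (\<Sum>m\<in>?S. Poly_Mapping.lookup p m * g m)"
    by (intro linear_ext_superset) auto
  moreover have "linear_ext g q = (\<Sum>m\<in>?S. Poly_Mapping.lookup q m * g m)"
    by (intro linear_ext_superset) auto
  ultimately show ?thesis
    by (simp add: lookup_add distrib_right sum.distrib)
qed

lemma linear_ext_scale: "linear_ext g (scale_mpoly c p) = c * linear_ext g p"
  by (subst linear_ext_superset[OF finite_keys keys_scale_mpoly])
    (simp add: linear_ext_def sum_distrib_left mult.assoc)

lemma linear_ext_0 [simp]: "linear_ext g 0 = 0"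
  by (simp add: linear_ext_def)

lemma linear_ext_sum: "linear_ext g (\<Sum>i\<in>A. f i) = (\<Sum>i\<in>A. linear_ext g (f i))"
  by (induction A rule: infinite_finite_induct) (auto simp: linear_ext_add)

lemma linear_ext_single: "linear_ext g (Poly_Mapping.single m c) = c * g m"
  by (cases "c = 0") (auto simp: linear_ext_def)

lemma linear_ext_unique:
  fixes \<phi> :: "('v, 'a::field) mpoly \<Rightarrow> 'a"
  assumes "\<And>p q. \<phi> (p + q) = \<phi> p + \<phi> q" and "\<And>c p. \<phi> (scale_mpoly c p) = c * \<phi> p"
  shows "\<phi> p = linear_ext (\<lambda>m. \<phi> (Poly_Mapping.single m 1)) p"
proof -
  have "\<phi> 0 = 0" using assms(2)[of 0 0] by simp
  then have "\<phi> (\<Sum>i\<in>A. f i) = (\<Sum>i\<in>A. \<phi> (f i))" for A and f :: "('v \<Rightarrow>\<^sub>0 nat) \<Rightarrow> _"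
    by (induction A rule: infinite_finite_induct) (auto simp: assms(1))
  then show ?thesis
    by (subst mpoly_eq_sum_monomials) (simp add: assms(2) linear_ext_def)
qed

section \<open>Evaluation as a ring homomorphism\<close>

lemma eval_eq_linear_ext:
  "eval x p = linear_ext (\<lambda>m. \<Prod>v\<in>UNIV. x v ^ Poly_Mapping.lookup m v) p"
  by (simp add: eval_def linear_ext_def)

lemma eval_add: "eval x (p + q) = eval x p + eval x q"
  by (simp add: eval_eq_linear_ext linear_ext_add)

lemma eval_scale: "eval x (scale_mpoly c p) = c * eval x p"
  by (simp add: eval_eq_linear_ext linear_ext_scale)

lemma eval_0 [simp]: "eval x 0 = 0"
  by (simp add: eval_def)

lemma eval_sum: "eval x (\<Sum>i\<in>A. f i) = (\<Sum>i\<in>A. eval x (f i))"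
  by (simp add: eval_eq_linear_ext linear_ext_sum)

lemma eval_diff: "eval x (p - q) = eval x p - eval x q"
  using eval_add[of x "p - q" q] by simp

lemma eval_single:
  "eval x (Poly_Mapping.single m c) = c * (\<Prod>v\<in>UNIV. x v ^ Poly_Mapping.lookup m v)"
  by (simp add: eval_eq_linear_ext linear_ext_single)

lemma eval_mult: "eval x (p * q) = eval x p * eval x q"
proof -
  have "p * q = (\<Sum>m\<in>Poly_Mapping.keys p. \<Sum>k\<in>Poly_Mapping.keys q.
      Poly_Mapping.single (m + k) (Poly_Mapping.lookup p m * Poly_Mapping.lookup q k))"
    by (subst (1) mpoly_eq_sum_monomials[of p], subst (1) mpoly_eq_sum_monomials[of q])
      (simp add: sum_product scale_mpoly_single mult_single)
  then have "eval x (p * q) = eval x (\<Sum>m\<in>Poly_Mapping.keys p. \<Sum>k\<in>Poly_Mapping.keys q.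
      Poly_Mapping.single (m + k) (Poly_Mapping.lookup p m * Poly_Mapping.lookup q k))"
    by (rule arg_cong)
  then show ?thesis
    unfolding eval_def[of x p] eval_def[of x q]
    by (simp add: eval_sum eval_single lookup_add power_add prod.distrib sum_product ac_simps)
qed

lemma eval_one [simp]: "eval x 1 = 1"
  using eval_single[of x 0 1] by simp

lemma prod_power_single: "(\<Prod>w\<in>UNIV. (x::'v::finite \<Rightarrow> 'a::field) w ^ Poly_Mapping.lookup (Poly_Mapping.single v 1) w) = x v"
proof -
  have "(\<Prod>w\<in>UNIV. x w ^ Poly_Mapping.lookup (Poly_Mapping.single v 1) w) =
      (\<Prod>w\<in>UNIV. if w = v then x w else 1)"
    by (intro prod.cong) (auto simp: lookup_single when_def)
  then show ?thesis by simp
qed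

lemma eval_Var: "eval x (Var v) = x v"
  by (simp add: Var_def eval_single prod_power_single del: One_nat_def)

lemma eval_linear_form: "eval x (linear_form a) = (\<Sum>v\<in>UNIV. a v * x v)"
  by (simp add: linear_form_def eval_sum eval_scale eval_Var)

text \<open>Monomials are distinct characters of the monoid of points under pointwise
  multiplication, so this is Artin's independence of characters.\<close>

lemma monomials_independent:
  fixes c :: "('v::finite \<Rightarrow>\<^sub>0 nat) \<Rightarrow> 'a::field_char_0"
  assumes "finite S" and "\<And>x. (\<Sum>m\<in>S. c m * (\<Prod>v\<in>UNIV. x v ^ Poly_Mapping.lookup m v)) = 0"
  shows "\<forall>m\<in>S. c m = 0"
  using assms
proof (induction S arbitrary: c rule: finite_induct)
  case (insert k S)
  define \<chi> where "\<chi> m x = (\<Prod>v\<in>UNIV. x v ^ Poly_Mapping.lookup m v)" for m and x :: "'v \<Rightarrow> 'a"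
  have mult: "\<chi> m (\<lambda>v. x v * y v) = \<chi> m x * \<chi> m y" for m x y
    by (simp add: \<chi>_def power_mult_distrib prod.distrib)
  have 0: "(\<Sum>m\<in>insert k S. c m * \<chi> m x) = 0" for x
    using insert.prems by (simp add: \<chi>_def)
  \<comment> \<open>Evaluating the relation at the pointwise product of \<open>x\<close> and
    \<open>y\<close> and subtracting \<open>\<chi> k y\<close> times the relation at
    \<open>x\<close> cancels the term of \<open>k\<close>.\<close>
  have S0: "\<forall>m\<in>S. c m * (\<chi> m y - \<chi> k y) = 0" for y
  proof (rule insert.IH)
    fix x
    have "(\<Sum>m\<in>insert k S. c m * \<chi> m (\<lambda>v. x v * y v)) - \<chi> k y * (\<Sum>m\<in>insert k S. c m * \<chi> m x) = 0"
      by (simp only: 0) simp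
    also have "(\<Sum>m\<in>insert k S. c m * \<chi> m (\<lambda>v. x v * y v)) - \<chi> k y * (\<Sum>m\<in>insert k S. c m * \<chi> m x) =
        (\<Sum>m\<in>S. c m * (\<chi> m y - \<chi> k y) * \<chi> m x)"
      using insert.hyps
      by (simp add: mult sum_distrib_left sum_subtractf algebra_simps)
    finally show "(\<Sum>m\<in>S. c m * (\<chi> m y - \<chi> k y) * (\<Prod>v\<in>UNIV. x v ^ Poly_Mapping.lookup m v)) = 0"
      by (simp add: \<chi>_def)
  qed
  have cS: "c m = 0" if "m \<in> S" for m
  proof -
    have "m \<noteq> k" using that insert.hyps by auto
    then obtain w where w: "Poly_Mapping.lookup m w \<noteq> Poly_Mapping.lookup k w"
      by (meson poly_mapping_eqI)
    \<comment> \<open>At this point every monomial takes the value 2 to the power of its exponent at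
      \<open>w\<close>, and distinct powers of 2 stay distinct in characteristic zero.\<close>
    define y where "y = (\<lambda>v. if v = w then 2 else 1 :: 'a)"
    have "\<chi> j y = 2 ^ Poly_Mapping.lookup j w" for j
    proof -
      have "\<chi> j y = (\<Prod>v\<in>UNIV. if v = w then 2 ^ Poly_Mapping.lookup j v else 1)"
        unfolding \<chi>_def y_def by (intro prod.cong) auto
      then show ?thesis by simp
    qed
    moreover have "(2::'a) ^ Poly_Mapping.lookup m w \<noteq> 2 ^ Poly_Mapping.lookup k w"
    proof
      assume "(2::'a) ^ Poly_Mapping.lookup m w = 2 ^ Poly_Mapping.lookup k w"
      then have "of_nat (2 ^ Poly_Mapping.lookup m w) = (of_nat (2 ^ Poly_Mapping.lookup k w) :: 'a)"
        by simp
      then show False using w by (simp only: of_nat_eq_iff) simp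
    qed
    ultimately show ?thesis using S0[of y] that by auto
  qed
  moreover have "c k = 0"
    using 0[of "\<lambda>_. 1"] insert.hyps cS by (simp add: \<chi>_def)
  ultimately show ?case by blast
qed simp

section \<open>Points where polynomials do not vanish\<close>

lemma exists_eval_neq_0:
  fixes p :: "('v::finite, 'a::field_char_0) mpoly"
  assumes "p \<noteq> 0"
  obtains x where "eval x p \<noteq> 0"
proof -
  have "\<not> (\<forall>x. eval x p = 0)"
  proof
    assume "\<forall>x. eval x p = 0"
    then have "\<forall>m\<in>Poly_Mapping.keys p. Poly_Mapping.lookup p m = 0"
      by (intro monomials_independent) (auto simp: eval_def)
    then show False using assms by (auto simp: in_keys_iff intro: poly_mapping_eqI)
  qed
  then show ?thesis using that by blast
qed

lemma eval_on_line:
  fixes p :: "('v::finite, 'a::field) mpoly"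
  obtains q where "\<And>t. poly q t = eval (\<lambda>v. x v + t * (y v - x v)) p"
proof
  show "poly (\<Sum>m\<in>Poly_Mapping.keys p. smult (Poly_Mapping.lookup p m)
      (\<Prod>v\<in>UNIV. [:x v, y v - x v:] ^ Poly_Mapping.lookup m v)) t = eval (\<lambda>v. x v + t * (y v - x v)) p" for t
    by (simp add: eval_def poly_sum poly_prod)
qed

text \<open>On the line through \<open>x\<close> and \<open>y\<close> both polynomials become
  nonzero polynomials in \<open>t\<close>: the first is nonzero at \<open>t = 0\<close>, the second
  at \<open>t = 1\<close>. Their product has finitely many roots, and the field is infinite.\<close>

lemma common_nonzero:
  fixes p q :: "('v::finite, 'a::field_char_0) mpoly"
  assumes "eval x p \<noteq> 0" and "eval y q \<noteq> 0"
  obtains z where "eval z p \<noteq> 0" "eval z q \<noteq> 0"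
proof -
  obtain p' where p': "\<And>t. poly p' t = eval (\<lambda>v. x v + t * (y v - x v)) p"
    using eval_on_line by metis
  obtain q' where q': "\<And>t. poly q' t = eval (\<lambda>v. x v + t * (y v - x v)) q"
    using eval_on_line by metis
  have "p' \<noteq> 0" using p'[of 0] assms(1) by auto
  moreover have "q' \<noteq> 0" using q'[of 1] assms(2) by auto
  ultimately have "finite {t. poly (p' * q') t = 0}"
    by (intro poly_roots_finite) simp
  then obtain t where "poly (p' * q') t \<noteq> 0"
    by (metis (mono_tags) ex_new_if_finite infinite_UNIV_char_0 mem_Collect_eq)
  then show ?thesis using that p' q' by auto
qed

lemma mult_neq_0:
  fixes p q :: "('v::finite, 'a::field_char_0) mpoly"
  assumes "p \<noteq> 0" and "q \<noteq> 0"
  shows "p * q \<noteq> 0"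
proof
  assume 0: "p * q = 0"
  obtain x y where "eval x p \<noteq> 0" "eval y q \<noteq> 0"
    using assms exists_eval_neq_0 by metis
  then obtain z where "eval z p \<noteq> 0" "eval z q \<noteq> 0"
    using common_nonzero by blast
  then show False using eval_mult[of z p q] 0 by simp
qed

section \<open>Forms\<close>

lemma mdeg_add: "mdeg (m + k) = mdeg m + mdeg k"
  by (simp add: mdeg_def lookup_add sum.distrib)

lemma mdeg_single [simp]: "mdeg (Poly_Mapping.single v k) = k"
proof -
  have "mdeg (Poly_Mapping.single v k) = (\<Sum>w\<in>UNIV. if w = v then k else 0)"
    unfolding mdeg_def by (intro sum.cong) (auto simp: lookup_single when_def)
  then show ?thesis by simp
qed

lemma mdeg_eq_0_iff [simp]: "mdeg m = 0 \<longleftrightarrow> m = 0"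
  by (auto simp: mdeg_def intro: poly_mapping_eqI)

text \<open>Listing the variables identifies exponent vectors of degree \<open>e\<close> with lists
  of naturals of sum \<open>e\<close>, which are counted by stars and bars.\<close>

lemma finite_card_mdeg:
  fixes e :: nat
  defines "M \<equiv> {m :: 'v::finite \<Rightarrow>\<^sub>0 nat. mdeg m = e}"
  shows "finite M" and "card M = (CARD('v) - 1 + e) choose e"
proof -
  obtain xs :: "'v list" where xs: "set xs = UNIV" "distinct xs"
    using finite_distinct_list[of "UNIV :: 'v set"] by auto
  then have len: "length xs = CARD('v)"
    using distinct_card by fastforce
  let ?L = "{l :: nat list. length l = CARD('v) \<and> sum_list l = e}"
  let ?f = "\<lambda>m. map (Poly_Mapping.lookup m) xs"
  have deg: "mdeg m = sum_list (?f m)" for m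
    using xs by (simp add: mdeg_def sum_list_distinct_conv_sum_set)
  have bij: "bij_betw ?f M ?L"
    unfolding bij_betw_def
  proof
    show "inj_on ?f M"
      using xs(1) by (intro inj_onI poly_mapping_eqI) auto
    show "?f ` M = ?L"
    proof
      show "?f ` M \<subseteq> ?L"
        using deg by (auto simp: M_def len)
      show "?L \<subseteq> ?f ` M"
      proof
        fix l assume l: "l \<in> ?L"
        define m where "m = Abs_poly_mapping (\<lambda>v. the (map_of (zip xs l) v))"
        have m: "?f m = l"
          using l xs(2) len by (intro nth_equalityI) (auto simp: m_def map_of_zip_nth)
        then show "l \<in> ?f ` M"
          using l deg[of m] by (auto simp: M_def intro!: image_eqI[of _ _ m])
      qed
    qed
  qed
  have "finite ?L"
  proof (rule finite_subset)
    show "?L \<subseteq> {l. set l \<subseteq> {..e} \<and> length l = CARD('v)}"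
      using member_le_sum_list by fastforce
  qed (intro finite_lists_length_eq finite_atMost)
  then show "finite M"
    using bij bij_betw_finite by blast
  have "0 < CARD('v)" by simp
  then show "card M = (CARD('v) - 1 + e) choose e"
    using bij_betw_same_card[OF bij] by (simp add: card_length_sum_list add.commute)
qed

lemma forms_0 [simp]: "0 \<in> forms e"
  by (simp add: forms_def)

lemma forms_add: "p \<in> forms e \<Longrightarrow> q \<in> forms e \<Longrightarrow> p + q \<in> forms e"
  using keys_add by (fastforce simp: forms_def)

lemma forms_scale: "p \<in> forms e \<Longrightarrow> scale_mpoly c p \<in> forms e"
  using keys_scale_mpoly by (fastforce simp: forms_def)

lemma forms_diff: "p \<in> forms e \<Longrightarrow> q \<in> forms e \<Longrightarrow> p - q \<in> forms e"
  using forms_add[of p e "scale_mpoly (-1) q"] forms_scale[of q e "-1"]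
  by (simp add: scale_mpoly_def Const_def single_uminus)

lemma forms_sum: "(\<And>i. i \<in> A \<Longrightarrow> f i \<in> forms e) \<Longrightarrow> (\<Sum>i\<in>A. f i) \<in> forms e"
  by (induction A rule: infinite_finite_induct) (auto simp: forms_add)

lemma subspace_forms: "mpoly_space.subspace (forms e)"
  by (simp add: mpoly_space.subspace_def forms_add forms_scale)

lemma forms_mult: "p \<in> forms i \<Longrightarrow> q \<in> forms j \<Longrightarrow> p * q \<in> forms (i + j)"
  using keys_mult[of p q] by (fastforce simp: forms_def mdeg_add)

lemma single_in_forms: "mdeg m = e \<Longrightarrow> Poly_Mapping.single m c \<in> forms e"
  by (auto simp: forms_def)

lemma Var_in_forms: "Var v \<in> forms 1"
  by (simp add: Var_def single_in_forms)

lemma linear_form_in_forms: "linear_form a \<in> forms 1"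
  unfolding linear_form_def by (intro forms_sum forms_scale Var_in_forms)

lemma forms_eq_sum:
  fixes p :: "('v::finite, 'a::field) mpoly"
  assumes "p \<in> forms e"
  shows "p = (\<Sum>m | mdeg m = e. scale_mpoly (Poly_Mapping.lookup p m) (Poly_Mapping.single m 1))"
proof -
  have "(\<Sum>m\<in>Poly_Mapping.keys p. scale_mpoly (Poly_Mapping.lookup p m) (Poly_Mapping.single m 1)) =
      (\<Sum>m | mdeg m = e. scale_mpoly (Poly_Mapping.lookup p m) (Poly_Mapping.single m 1))"
    using assms by (intro sum.mono_neutral_left) (auto simp: finite_card_mdeg forms_def in_keys_iff)
  with mpoly_eq_sum_monomials[of p] show ?thesis by (rule trans)
qed

lemma span_monomials:
  "mpoly_space.span ((\<lambda>m. Poly_Mapping.single m 1) ` {m. mdeg m = e}) =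
    (forms e :: ('v::finite, 'a::field) mpoly set)"
proof
  show "forms e \<subseteq> mpoly_space.span ((\<lambda>m. Poly_Mapping.single m (1::'a)) ` {m :: 'v \<Rightarrow>\<^sub>0 nat. mdeg m = e})"
  proof
    fix p :: "('v, 'a) mpoly" assume "p \<in> forms e"
    then show "p \<in> mpoly_space.span ((\<lambda>m. Poly_Mapping.single m (1::'a)) ` {m :: 'v \<Rightarrow>\<^sub>0 nat. mdeg m = e})"
      unfolding mpoly_space.in_span_family_iff[OF finite_card_mdeg(1)]
      by (intro exI[of _ "Poly_Mapping.lookup p"] forms_eq_sum)
  qed
qed (intro mpoly_space.span_minimal subspace_forms, auto intro: single_in_forms)

lemma lin_indep_monomials: "lin_indep_family scale_mpoly {m. mdeg m = e}
    (\<lambda>m. Poly_Mapping.single m 1 :: ('v::finite, 'a::field) mpoly)"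
  unfolding lin_indep_family_def
proof (intro allI impI ballI)
  fix c :: "('v \<Rightarrow>\<^sub>0 nat) \<Rightarrow> 'a" and m :: "'v \<Rightarrow>\<^sub>0 nat"
  assume 0: "(\<Sum>m | mdeg m = e. scale_mpoly (c m) (Poly_Mapping.single m 1)) = 0" and m: "m \<in> {m. mdeg m = e}"
  have "c m = Poly_Mapping.lookup (\<Sum>m | mdeg m = e. scale_mpoly (c m) (Poly_Mapping.single m 1)) m"
    using m by (simp add: lookup_sum lookup_single when_def if_distrib finite_card_mdeg sum.delta cong: if_cong)
  then show "c m = 0" by (simp add: 0)
qed

lemma dim_forms:
  "mpoly_space.dim (forms e :: ('v::finite, 'a::field) mpoly set) = (CARD('v) - 1 + e) choose e"
  using mpoly_space.dim_span_family_eq_iff[OF finite_card_mdeg(1), where v = "\<lambda>m :: 'v \<Rightarrow>\<^sub>0 nat. Poly_Mapping.single m (1::'a)" and e1 = e]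
    lin_indep_monomials[of e]
  by (simp only: span_monomials finite_card_mdeg(2))

lemma linear_form_neq_0:
  assumes "a \<noteq> 0"
  shows "linear_form a \<noteq> 0"
proof
  obtain v where "a v \<noteq> 0" using assms by (auto simp: fun_eq_iff)
  moreover assume "linear_form a = 0"
  then have "eval (\<lambda>w. if w = v then 1 else 0) (linear_form a) = 0" by simp
  ultimately show False by (simp add: eval_linear_form if_distrib cong: if_cong)
qed

section \<open>Divisibility by a linear form\<close>

text \<open>Modulo the linear form, the variable \<open>v\<close> is a combination of the other ones, so that
  \<open>p\<close> may be replaced by a form \<open>q\<close> not involving \<open>v\<close>.\<close>

lemma form_mod_linear_form:
  fixes p :: "('v::finite, 'a::field) mpoly"
  assumes "a v \<noteq> 0" and "p \<in> forms (Suc e)"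
  obtains f q where "f \<in> forms e" "p = linear_form a * f + q"
    "\<forall>m\<in>Poly_Mapping.keys q. Poly_Mapping.lookup m v = 0"
proof -
  define free where "free = {q :: ('v, 'a) mpoly. \<forall>m\<in>Poly_Mapping.keys q. Poly_Mapping.lookup m v = 0}"
  define S where "S = {linear_form a * f + q | f q. f \<in> forms e \<and> q \<in> free}"
  have free_add: "p + q \<in> free" if "p \<in> free" "q \<in> free" for p q
    using keys_add[of p q] that by (auto simp: free_def)
  have free_scale: "scale_mpoly c p \<in> free" if "p \<in> free" for c p
    using keys_scale_mpoly[of c p] that by (auto simp: free_def)
  have S: "mpoly_space.subspace S"
    unfolding mpoly_space.subspace_def
  proof (intro conjI ballI allI)
    show "0 \<in> S" unfolding S_def by (intro CollectI exI[of _ 0]) (auto simp: free_def)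
  next
    fix x y assume "x \<in> S" "y \<in> S"
    then obtain f q f' q' where "f \<in> forms e" "f' \<in> forms e" "q \<in> free" "q' \<in> free"
      "x = linear_form a * f + q" "y = linear_form a * f' + q'"
      unfolding S_def by blast
    then show "x + y \<in> S" unfolding S_def
      by (intro CollectI exI[of _ "f + f'"] exI[of _ "q + q'"]) (auto simp: forms_add free_add algebra_simps)
  next
    fix c x assume "x \<in> S"
    then obtain f q where "f \<in> forms e" "q \<in> free" "x = linear_form a * f + q"
      unfolding S_def by blast
    then show "scale_mpoly c x \<in> S" unfolding S_def
      by (intro CollectI exI[of _ "scale_mpoly c f"] exI[of _ "scale_mpoly c q"])
        (auto simp: forms_scale free_scale mpoly_space.scale_right_distrib mult_scale_mpoly_right)
  qed
  \<comment> \<open>Induction on the exponent of \<open>v\<close>. The product of the linear form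
    with the monomial divided by the variable \<open>v\<close> contains the monomial itself with
    nonzero coefficient \<open>a v\<close>; its other terms have a smaller exponent of
    \<open>v\<close>.\<close>
  have mon: "Poly_Mapping.single m 1 \<in> S" if "mdeg m = Suc e" for m
    using that
  proof (induction "Poly_Mapping.lookup m v" arbitrary: m)
    case 0
    then show ?case unfolding S_def
      by (intro CollectI exI[of _ 0] exI[of _ "Poly_Mapping.single m 1"]) (auto simp: free_def)
  next
    case (Suc k)
    define m' where "m' = m - Poly_Mapping.single v 1"
    have m: "m = Poly_Mapping.single v 1 + m'"
      using Suc.hyps(2) unfolding m'_def
      by (intro poly_mapping_eqI) (auto simp: lookup_add lookup_minus lookup_single when_def)
    have m': "mdeg m' = e" "Poly_Mapping.lookup m' v = k"
      using Suc.prems Suc.hyps(2) m by (auto simp: mdeg_add lookup_add)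
    let ?t = "\<lambda>w. Poly_Mapping.single (Poly_Mapping.single w 1 + m') 1 :: ('v, 'a) mpoly"
    have "linear_form a * Poly_Mapping.single m' 1 = (\<Sum>w\<in>UNIV. scale_mpoly (a w) (?t w))"
      by (simp add: linear_form_def sum_distrib_right Var_def scale_mpoly_single mult_single)
    also have "\<dots> = scale_mpoly (a v) (?t v) + (\<Sum>w\<in>UNIV - {v}. scale_mpoly (a w) (?t w))"
      by (simp add: sum.remove)
    finally have "?t v = scale_mpoly (inverse (a v)) (linear_form a * Poly_Mapping.single m' 1 -
        (\<Sum>w\<in>UNIV - {v}. scale_mpoly (a w) (?t w)))"
      using assms(1) by simp
    moreover have "?t w \<in> S" if "w \<noteq> v" for w
      using that m' by (intro Suc.hyps(1)) (auto simp: mdeg_add lookup_add lookup_single)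
    moreover have "linear_form a * Poly_Mapping.single m' 1 \<in> S" unfolding S_def
      by (intro CollectI exI[of _ "Poly_Mapping.single m' 1"] exI[of _ 0])
        (auto simp: free_def single_in_forms m')
    ultimately have "?t v \<in> S"
      using S by (auto intro!: mpoly_space.subspace_scale mpoly_space.subspace_diff mpoly_space.subspace_sum)
    then show ?case using m by simp
  qed
  have "(\<lambda>m. Poly_Mapping.single m 1) ` {m. mdeg m = Suc e} \<subseteq> S"
    using mon by auto
  from mpoly_space.span_minimal[OF this S] have "p \<in> S"
    using assms(2) by (auto simp: span_monomials)
  then show ?thesis using that unfolding S_def free_def by blast
qed

lemma eval_free_variable:
  assumes "\<forall>m\<in>Poly_Mapping.keys q. Poly_Mapping.lookup m v = 0" and "\<And>w. w \<noteq> v \<Longrightarrow> x w = y w"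
  shows "eval x q = eval y q"
proof -
  have "(\<Prod>w\<in>UNIV. x w ^ Poly_Mapping.lookup m w) = (\<Prod>w\<in>UNIV. y w ^ Poly_Mapping.lookup m w)"
    if "m \<in> Poly_Mapping.keys q" for m
    proof (intro prod.cong refl)
    show "x w ^ Poly_Mapping.lookup m w = y w ^ Poly_Mapping.lookup m w" for w
      using assms that by (cases "w = v") auto
  qed
  then show ?thesis unfolding eval_def by (intro sum.cong) auto
qed

text \<open>The remainder \<open>q\<close> vanishes on the hyperplane along with \<open>p\<close>.
  It does not involve a variable \<open>v\<close> with \<open>a v\<close> nonzero, and changing that
  coordinate moves any point into the hyperplane, so \<open>q\<close> vanishes everywhere.\<close>

lemma linear_form_dvd_if_vanishing:
  fixes p :: "('v::finite, 'a::field_char_0) mpoly"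
  assumes "a \<noteq> 0" and "p \<in> forms (Suc e)" and "\<And>x. x \<in> hyperplane a \<Longrightarrow> eval x p = 0"
  obtains f where "f \<in> forms e" "p = linear_form a * f"
proof -
  obtain v where v: "a v \<noteq> 0" using assms(1) by (auto simp: fun_eq_iff)
  obtain f q where f: "f \<in> forms e" "p = linear_form a * f + q"
    and q: "\<forall>m\<in>Poly_Mapping.keys q. Poly_Mapping.lookup m v = 0"
    using form_mod_linear_form[where a = a and v = v, OF v assms(2)] by blast
  have "eval x q = 0" for x
  proof -
    \<comment> \<open>The coordinate at \<open>v\<close> is obtained by solving the equation of the
      hyperplane for it.\<close>
    define y where "y = x(v := - (\<Sum>w\<in>UNIV - {v}. a w * x w) / a v)"
    have "(\<Sum>w\<in>UNIV. a w * y w) = a v * y v + (\<Sum>w\<in>UNIV - {v}. a w * y w)"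
      by (simp add: sum.remove)
    also have "(\<Sum>w\<in>UNIV - {v}. a w * y w) = (\<Sum>w\<in>UNIV - {v}. a w * x w)"
      by (intro sum.cong) (auto simp: y_def)
    finally have y: "eval y (linear_form a) = 0"
      using v by (simp add: eval_linear_form y_def)
    then have "eval y p = 0"
      using assms(3) by (simp add: hyperplane_def)
    then have "eval y q = 0"
      using f(2) y by (simp add: eval_add eval_mult)
    then show ?thesis
      using eval_free_variable[OF q, of x y] by (simp add: y_def)
  qed
  then have "q = 0" using exists_eval_neq_0 by blast
  then show ?thesis using that f by simp
qed

section \<open>Ideals generated in one degree\<close>

definition hom_part :: "nat \<Rightarrow> ('v::finite, 'a::field) mpoly \<Rightarrow> ('v, 'a) mpoly" where
  "hom_part e p = (\<Sum>m | m \<in> Poly_Mapping.keys p \<and> mdeg m = e.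
     Poly_Mapping.single m (Poly_Mapping.lookup p m))"

lemma lookup_hom_part:
  "Poly_Mapping.lookup (hom_part e p) m = (if mdeg m = e then Poly_Mapping.lookup p m else 0)"
  by (simp add: hom_part_def lookup_sum lookup_single when_def sum.delta in_keys_iff)

lemma hom_part_add: "hom_part e (p + q) = hom_part e p + hom_part e q"
  by (intro poly_mapping_eqI) (simp add: lookup_hom_part lookup_add)

lemma hom_part_form: "p \<in> forms e \<Longrightarrow> hom_part e p = p"
  by (intro poly_mapping_eqI) (auto simp: lookup_hom_part forms_def in_keys_iff)

text \<open>Only the constant term of \<open>c\<close> contributes in degree \<open>d\<close>. Thus
  ring coefficients act on generators of degree \<open>d\<close> as scalars in that degree.\<close>

lemma hom_part_mult_form:
  assumes "p \<in> forms d"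
  shows "hom_part d (c * p) = scale_mpoly (Poly_Mapping.lookup c 0) p"
proof (rule poly_mapping_eqI)
  fix m
  define c' where "c' = c - Const (Poly_Mapping.lookup c 0)"
  have c': "Poly_Mapping.lookup c' 0 = 0"
    by (simp add: c'_def Const_def lookup_minus)
  have "c * p = c' * p + scale_mpoly (Poly_Mapping.lookup c 0) p"
    by (simp add: c'_def scale_mpoly_def algebra_simps)
  moreover have "Poly_Mapping.lookup (c' * p) m = 0" if "mdeg m = d"
  proof (rule ccontr)
    assume "\<not> ?thesis"
    then have "m \<in> Poly_Mapping.keys (c' * p)"
      by (simp add: in_keys_iff)
    then obtain k l where kl: "m = k + l" "k \<in> Poly_Mapping.keys c'" "l \<in> Poly_Mapping.keys p"
      using keys_mult by blast
    then have "mdeg k = 0" using assms that by (auto simp: mdeg_add forms_def)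
    then show False using kl c' by (simp add: in_keys_iff)
  qed
  moreover have "Poly_Mapping.lookup p m = 0" if "mdeg m \<noteq> d"
    using assms that by (auto simp: forms_def in_keys_iff)
  ultimately show "Poly_Mapping.lookup (hom_part d (c * p)) m =
      Poly_Mapping.lookup (scale_mpoly (Poly_Mapping.lookup c 0) p) m"
    by (simp add: lookup_hom_part lookup_add)
qed

text \<open>Together the two claims describe the ideal up to degree \<open>d\<close>: it is zero
  below, and in degree \<open>d\<close> it is the linear span of the generators.\<close>

lemma ideal_generated_degree:
  assumes "S \<subseteq> forms d" and "u \<in> ideal_generated S"
  shows "(\<forall>m\<in>Poly_Mapping.keys u. d \<le> mdeg m) \<and> hom_part d u \<in> mpoly_space.span S"
  using assms(2) unfolding ideal_generated_def
proof (induction rule: mpoly_module.span_induct_alt)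
  case base
  show ?case by (simp add: hom_part_def mpoly_space.span_zero)
next
  case (step c x y)
  have x: "x \<in> forms d" using step assms(1) by blast
  have "d \<le> mdeg m" if "m \<in> Poly_Mapping.keys (c * x)" for m
    using that keys_mult[of c x] x by (fastforce simp: mdeg_add forms_def)
  then have "\<forall>m\<in>Poly_Mapping.keys (c * x + y). d \<le> mdeg m"
    using step keys_add[of "c * x" y] by blast
  moreover have "hom_part d (c * x + y) \<in> mpoly_space.span S"
    using step by (simp add: hom_part_add hom_part_mult_form[OF x]
        mpoly_space.span_add mpoly_space.span_scale mpoly_space.span_base)
  ultimately show ?case ..
qed

lemma is_ideal_ideal_generated: "is_ideal (ideal_generated S)"
  by (simp add: is_ideal_def ideal_generated_def mpoly_module.subspace_span)

lemma span_subset_ideal_generated: "mpoly_space.span S \<subseteq> ideal_generated S"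
proof (rule mpoly_space.span_minimal)
  show "S \<subseteq> ideal_generated S"
    unfolding ideal_generated_def by (rule mpoly_module.span_superset)
  show "mpoly_space.subspace (ideal_generated S)"
    using mpoly_module.subspace_span[of S]
    unfolding mpoly_space.subspace_def mpoly_module.subspace_def ideal_generated_def scale_mpoly_def
    by blast
qed

lemma ideal_generated_same_degree:
  assumes "S \<subseteq> forms d"
  shows "ideal_generated S \<inter> forms d = mpoly_space.span S"
proof
  show "ideal_generated S \<inter> forms d \<subseteq> mpoly_space.span S"
    using ideal_generated_degree[OF assms] hom_part_form by fastforce
  show "mpoly_space.span S \<subseteq> ideal_generated S \<inter> forms d"
    using span_subset_ideal_generated mpoly_space.span_minimal[OF assms subspace_forms] by blast
qed

lemma ideal_generated_lower_degree:
  assumes "S \<subseteq> forms d" and "e < d" and "u \<in> ideal_generated S" and "u \<in> forms e"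
  shows "u = 0"
proof -
  have "Poly_Mapping.keys u = {}"
    using ideal_generated_degree[OF assms(1,3)] assms(2,4) by (fastforce simp: forms_def)
  then show ?thesis by simp
qed

section \<open>The apolarity pairing\<close>

definition mfact :: "('v::finite \<Rightarrow>\<^sub>0 nat) \<Rightarrow> 'a::field_char_0" where
  "mfact m = (\<Prod>v\<in>UNIV. fact (Poly_Mapping.lookup m v))"

lemma mfact_neq_0 [simp]: "mfact m \<noteq> 0"
  by (simp add: mfact_def)

lemma mfact_0 [simp]: "mfact 0 = 1"
  by (simp add: mfact_def)

lemma mfact_add_single:
  "mfact (m + Poly_Mapping.single v 1) = of_nat (Poly_Mapping.lookup m v + 1) * mfact m"
proof -
  have "mfact (m + Poly_Mapping.single v 1) = (\<Prod>w\<in>UNIV.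
      (if w = v then of_nat (Poly_Mapping.lookup m w + 1) else 1) * fact (Poly_Mapping.lookup m w))"
    unfolding mfact_def by (intro prod.cong) (auto simp: lookup_add lookup_single)
  then show ?thesis by (simp add: mfact_def prod.distrib)
qed

text \<open>The value of \<open>\<partial>\<^sup>m p\<close> at the origin.\<close>

definition deriv0 :: "('v::finite, 'a::field_char_0) mpoly \<Rightarrow> ('v \<Rightarrow>\<^sub>0 nat) \<Rightarrow> 'a" where
  "deriv0 p m = mfact m * Poly_Mapping.lookup p m"

text \<open>The factor \<open>mfact\<close> absorbs the numerical factors produced by
  differentiation, which is left as a mere shift of the exponent.\<close>

lemma deriv0_pdiff: "deriv0 (pdiff v p) m = deriv0 p (m + Poly_Mapping.single v 1)"
  by (simp add: deriv0_def lookup_pdiff mfact_add_single del: One_nat_def)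

lemma deriv0_pdiff_power: "deriv0 ((pdiff v ^^ k) p) m = deriv0 p (m + Poly_Mapping.single v k)"
proof (induction k arbitrary: m)
  case (Suc k)
  have "Poly_Mapping.single v (Suc k) = Poly_Mapping.single v 1 + Poly_Mapping.single v k"
    by (simp flip: single_add)
  then show ?case using Suc by (simp add: deriv0_pdiff add.assoc)
qed simp

lemma deriv0_pdiffs: "deriv0 (pdiffs \<alpha> p) m = deriv0 p (m + \<alpha>)"
proof -
  interpret comp_fun_commute "\<lambda>v. pdiff v ^^ Poly_Mapping.lookup \<alpha> v"
    by (rule pdiffs_comp_fun_commute)
  have "deriv0 (Finite_Set.fold (\<lambda>v. pdiff v ^^ Poly_Mapping.lookup \<alpha> v) p A) m =
      deriv0 p (m + (\<Sum>v\<in>A. Poly_Mapping.single v (Poly_Mapping.lookup \<alpha> v)))" if "finite A" for A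
    using that
  proof (induction A arbitrary: m rule: finite_induct)
    case (insert v A)
    then show ?case by (simp add: deriv0_pdiff_power add.assoc)
  qed simp
  moreover have "(\<Sum>v\<in>UNIV. Poly_Mapping.single v (Poly_Mapping.lookup \<alpha> v)) = \<alpha>"
    by (intro poly_mapping_eqI) (simp add: lookup_sum lookup_single when_def)
  ultimately show ?thesis by (simp add: pdiffs_def)
qed

lemma deriv0_add: "deriv0 (p + q) m = deriv0 p m + deriv0 q m"
  by (simp add: deriv0_def lookup_add distrib_left)

lemma deriv0_scale: "deriv0 (scale_mpoly c p) m = c * deriv0 p m"
  by (simp add: deriv0_def)

lemma deriv0_0 [simp]: "deriv0 0 m = 0"
  by (simp add: deriv0_def)

lemma deriv0_form: "p \<in> forms d \<Longrightarrow> mdeg m \<noteq> d \<Longrightarrow> deriv0 p m = 0"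
  by (auto simp: deriv0_def forms_def in_keys_iff)

text \<open>The value at the origin of \<open>u\<close> acting on \<open>p\<close> by
  differentiation. On forms of one common degree this is the classical apolarity pairing.\<close>

definition apolar :: "('v::finite, 'a::field_char_0) mpoly \<Rightarrow> ('v, 'a) mpoly \<Rightarrow> 'a" where
  "apolar u p = linear_ext (deriv0 p) u"

lemma apolar_add_left: "apolar (u + w) p = apolar u p + apolar w p"
  by (simp add: apolar_def linear_ext_add)

lemma apolar_scale_left: "apolar (scale_mpoly c u) p = c * apolar u p"
  by (simp add: apolar_def linear_ext_scale)

lemma apolar_sum_left: "apolar (\<Sum>i\<in>A. u i) p = (\<Sum>i\<in>A. apolar (u i) p)"
  by (simp add: apolar_def linear_ext_sum)

lemma apolar_add_right: "apolar u (p + q) = apolar u p + apolar u q"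
  by (simp add: apolar_def linear_ext_def deriv0_add distrib_left sum.distrib)

lemma apolar_scale_right: "apolar u (scale_mpoly c p) = c * apolar u p"
  by (simp add: apolar_def linear_ext_def deriv0_scale sum_distrib_left mult.left_commute)

lemma apolar_span_left:
  assumes "\<And>u. u \<in> S \<Longrightarrow> apolar u p = 0" and "u \<in> mpoly_space.span S"
  shows "apolar u p = 0"
  using assms(2)
proof (induction rule: mpoly_space.span_induct_alt)
  case base
  show ?case by (simp add: apolar_def)
qed (simp add: apolar_add_left apolar_scale_left assms(1))

lemma apolar_span_right:
  assumes "\<And>p. p \<in> S \<Longrightarrow> apolar u p = 0" and "p \<in> mpoly_space.span S"
  shows "apolar u p = 0"
  using assms(2)
proof (induction rule: mpoly_space.span_induct_alt)
  case base
  show ?case by (simp add: apolar_def linear_ext_def)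
qed (simp add: apolar_add_right apolar_scale_right assms(1))

text \<open>For degree reasons \<open>u\<close> maps \<open>p\<close> to a constant, which is
  determined by its value at the origin. Only a lower bound on the degrees in \<open>u\<close> is
  assumed, so that inhomogeneous elements of the ideal are covered.\<close>

lemma diff_action_eq_0_iff:
  assumes "p \<in> forms d" and "\<And>m. m \<in> Poly_Mapping.keys u \<Longrightarrow> d \<le> mdeg m"
  shows "diff_action u p = 0 \<longleftrightarrow> apolar u p = 0"
proof -
  have 1: "deriv0 (diff_action u p) m =
      (\<Sum>\<alpha>\<in>Poly_Mapping.keys u. Poly_Mapping.lookup u \<alpha> * deriv0 p (m + \<alpha>))" for m
    unfolding deriv0_pdiffs[symmetric]
    by (simp add: diff_action_def deriv0_def lookup_sum sum_distrib_left mult.left_commute)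
  then have "deriv0 (diff_action u p) 0 = apolar u p"
    by (simp add: apolar_def linear_ext_def)
  moreover have "deriv0 (diff_action u p) m = 0" if "m \<noteq> 0" for m
  proof -
    have "mdeg m \<noteq> 0" using that by simp
    then have "mdeg (m + \<alpha>) \<noteq> d" if "\<alpha> \<in> Poly_Mapping.keys u" for \<alpha>
      using assms(2)[OF that] by (simp add: mdeg_add del: mdeg_eq_0_iff)
    then show ?thesis unfolding 1 by (simp add: deriv0_form[OF assms(1)])
  qed
  moreover have "diff_action u p = 0 \<longleftrightarrow> (\<forall>m. deriv0 (diff_action u p) m = 0)"
    by (auto simp: deriv0_def intro: poly_mapping_eqI)
  ultimately show ?thesis by metis
qed

lemma inverse_system_ideal_generated:
  assumes "S \<subseteq> forms d"
  shows "inverse_system (ideal_generated S) \<inter> forms d = {p \<in> forms d. \<forall>u\<in>S. apolar u p = 0}"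
proof (intro set_eqI iffI)
  fix p assume p: "p \<in> inverse_system (ideal_generated S) \<inter> forms d"
  have "apolar u p = 0" if "u \<in> S" for u
  proof -
    have "u \<in> ideal_generated S"
      using that span_subset_ideal_generated mpoly_space.span_base by blast
    then show ?thesis
      using p diff_action_eq_0_iff[of p d u] that assms
      by (auto simp: inverse_system_def forms_def)
  qed
  then show "p \<in> {p \<in> forms d. \<forall>u\<in>S. apolar u p = 0}" using p by blast
next
  fix p assume p: "p \<in> {p \<in> forms d. \<forall>u\<in>S. apolar u p = 0}"
  have "diff_action u p = 0" if "u \<in> ideal_generated S" for u
  proof -
    note u = ideal_generated_degree[OF assms that]
    \<comment> \<open>The part of \<open>u\<close> of degree \<open>d\<close> lies in the span of
      \<open>S\<close>; the remaining terms pair to zero with a form of degree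
      \<open>d\<close>.\<close>
    have "apolar u p = apolar (hom_part d u) p + apolar (u - hom_part d u) p"
      by (simp flip: apolar_add_left)
    also have "apolar (u - hom_part d u) p = 0"
      unfolding apolar_def linear_ext_def
    proof (intro sum.neutral ballI)
      show "Poly_Mapping.lookup (u - hom_part d u) m * deriv0 p m = 0" for m
        using p deriv0_form[of p d m] by (cases "mdeg m = d") (auto simp: lookup_minus lookup_hom_part)
    qed
    also have "apolar (hom_part d u) p = 0"
      using apolar_span_left u p by blast
    finally have "apolar u p = 0" by simp
    then show ?thesis
      using p u by (subst diff_action_eq_0_iff[of p d]) auto
  qed
  then show "p \<in> inverse_system (ideal_generated S) \<inter> forms d"
    using p by (simp add: inverse_system_def)
qed

text \<open>Nondegeneracy of the apolarity pairing, as a double annihilator statement: a linear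
  functional that is 0 on \<open>S\<close> and 1 at \<open>u\<close> is the pairing with some
  form.\<close>

lemma in_span_if_annihilated:
  fixes u :: "('v::finite, 'a::field_char_0) mpoly"
  assumes "u \<in> forms d" and "S \<subseteq> forms d"
    and ann: "\<And>p. p \<in> forms d \<Longrightarrow> \<forall>w\<in>S. apolar w p = 0 \<Longrightarrow> apolar u p = 0"
  shows "u \<in> mpoly_space.span S"
proof (rule ccontr)
  assume u: "u \<notin> mpoly_space.span S"
  have field: "vector_space ((*) :: 'a \<Rightarrow> 'a \<Rightarrow> 'a)"
    by (simp add: vector_space_def algebra_simps)
  obtain B where B: "B \<subseteq> S" "mpoly_space.independent B" "S \<subseteq> mpoly_space.span B"
    by (rule mpoly_space.basis_exists[of S])
  have uB: "u \<notin> mpoly_space.span B"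
    using u mpoly_space.span_mono[OF B(1)] by blast
  then have "mpoly_space.independent (insert u B)"
    using B(2) mpoly_space.independent_insertI by blast
  from vector_space_pair.linear_independent_extend[OF
      vector_space_pair.intro[OF mpoly_space.vector_space_axioms field] this, of "\<lambda>w. if w = u then 1 else 0"]
  obtain \<phi> where lin: "Vector_Spaces.linear scale_mpoly (*) \<phi>"
    and \<phi>: "\<And>w. w \<in> insert u B \<Longrightarrow> \<phi> w = (if w = u then 1 else 0)"
    by blast
  interpret \<phi>: Vector_Spaces.linear scale_mpoly "(*)" \<phi> by (rule lin)
  \<comment> \<open>The division by \<open>mfact\<close> makes \<open>deriv0 p m\<close> equal to
    the value of \<open>\<phi>\<close> on the monomial \<open>m\<close>, so that pairing with
    \<open>p\<close> is \<open>\<phi>\<close> on forms of degree \<open>d\<close>.\<close>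
  define p where "p = (\<Sum>m | mdeg m = d.
    Poly_Mapping.single m (\<phi> (Poly_Mapping.single m 1) / mfact m))"
  have p: "p \<in> forms d"
    unfolding p_def by (intro forms_sum single_in_forms) auto
  have deriv: "deriv0 p m = \<phi> (Poly_Mapping.single m 1)" if "mdeg m = d" for m
    using that
    by (simp add: deriv0_def p_def lookup_sum lookup_single when_def finite_card_mdeg sum.delta)
  have apolar: "apolar w p = \<phi> w" if "w \<in> forms d" for w
  proof -
    have "\<phi> w = linear_ext (\<lambda>m. \<phi> (Poly_Mapping.single m 1)) w"
      by (intro linear_ext_unique) (simp_all add: \<phi>.add \<phi>.scale)
    also have "\<dots> = apolar w p"
      using that deriv unfolding apolar_def linear_ext_def
      by (intro sum.cong) (auto simp: forms_def)
    finally show ?thesis by simp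
  qed
  have "\<phi> w = 0" if "w \<in> mpoly_space.span B" for w
    using that
  proof (induction rule: mpoly_space.span_induct_alt)
    case (step c x y)
    then have "x \<noteq> u" using uB mpoly_space.span_base by blast
    then show ?case using step \<phi>[of x] by (simp add: \<phi>.add \<phi>.scale)
  qed (simp add: \<phi>.zero)
  then have "\<forall>w\<in>S. apolar w p = 0"
    using B(3) apolar assms(2) by (simp add: subset_iff)
  then have "apolar u p = 0" using ann p by blast
  then show False using apolar[OF assms(1)] \<phi>[of u] by simp
qed

section \<open>Derivatives of order one less than the degree\<close>

lemma pdiffs_in_forms:
  fixes p :: "('v::finite, 'a::field_char_0) mpoly"
  assumes "p \<in> forms (mdeg \<alpha> + e)"
  shows "pdiffs \<alpha> p \<in> forms e"
  unfolding forms_def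
proof (intro CollectI ballI)
  fix m assume "m \<in> Poly_Mapping.keys (pdiffs \<alpha> p)"
  then have "deriv0 (pdiffs \<alpha> p) m \<noteq> 0"
    by (simp add: deriv0_def in_keys_iff)
  then have "mdeg (m + \<alpha>) = mdeg \<alpha> + e"
    using deriv0_form[OF assms] by (metis deriv0_pdiffs)
  then show "mdeg m = e" by (simp add: mdeg_add)
qed

lemma mdeg_eq_1_iff: "{m. mdeg m = 1} = range (\<lambda>v. Poly_Mapping.single v 1)"
proof (intro set_eqI iffI)
  fix m :: "'a \<Rightarrow>\<^sub>0 nat" assume m: "m \<in> {m. mdeg m = 1}"
  then have "m \<noteq> 0" by (auto simp flip: mdeg_eq_0_iff)
  then obtain v where v: "Poly_Mapping.lookup m v \<noteq> 0"
    by (metis poly_mapping_eqI lookup_zero)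
  define k where "k = m - Poly_Mapping.single v 1"
  have mk: "m = k + Poly_Mapping.single v 1"
    using v unfolding k_def
    by (intro poly_mapping_eqI) (auto simp: lookup_add lookup_minus lookup_single when_def)
  then have "mdeg k = 0"
    using m by (simp add: mdeg_add del: mdeg_eq_0_iff)
  then show "m \<in> range (\<lambda>v. Poly_Mapping.single v 1)"
    using mk by auto
qed auto

lemma eval_linear:
  assumes "p \<in> forms 1"
  shows "eval x p = (\<Sum>v\<in>UNIV. x v * Poly_Mapping.lookup p (Poly_Mapping.single v 1))"
proof -
  have inj: "inj (\<lambda>v. Poly_Mapping.single v (1::nat))"
    by (intro injI) (metis lookup_single_eq lookup_single_not_eq zero_neq_one)
  have "eval x p = (\<Sum>m | mdeg m = 1. Poly_Mapping.lookup p m * (\<Prod>v\<in>UNIV. x v ^ Poly_Mapping.lookup m v))"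
    unfolding eval_eq_linear_ext
    using assms by (intro linear_ext_superset finite_card_mdeg) (auto simp: forms_def)
  also have "\<dots> = (\<Sum>v\<in>UNIV. x v * Poly_Mapping.lookup p (Poly_Mapping.single v 1))"
    unfolding mdeg_eq_1_iff sum.reindex[OF inj] comp_def prod_power_single
    by (simp add: mult.commute)
  finally show ?thesis .
qed

text \<open>The derivative is a linear form, and its value at \<open>x\<close> is the result of
  letting \<open>linear_form x\<close> act on it. Both actions combine into that of a
  product.\<close>

lemma eval_pdiffs_eq_apolar:
  fixes p :: "('v::finite, 'a::field_char_0) mpoly"
  assumes "p \<in> forms (Suc (mdeg \<alpha>))"
  shows "eval x (pdiffs \<alpha> p) = apolar (linear_form x * Poly_Mapping.single \<alpha> 1) p"
proof -
  have "mfact (Poly_Mapping.single v 1) = (1::'a)" for v :: 'v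
    using mfact_add_single[of 0 v] by simp
  then have "Poly_Mapping.lookup (pdiffs \<alpha> p) (Poly_Mapping.single v 1) =
      deriv0 p (Poly_Mapping.single v 1 + \<alpha>)" for v
    using deriv0_pdiffs[of \<alpha> p "Poly_Mapping.single v 1"]
    by (simp add: deriv0_def[of "pdiffs \<alpha> p"] del: One_nat_def)
  moreover have "pdiffs \<alpha> p \<in> forms 1"
    using assms by (intro pdiffs_in_forms) simp
  ultimately have "eval x (pdiffs \<alpha> p) = (\<Sum>v\<in>UNIV. x v * deriv0 p (Poly_Mapping.single v 1 + \<alpha>))"
    by (simp add: eval_linear)
  also have "\<dots> = apolar (linear_form x * Poly_Mapping.single \<alpha> 1) p"
    by (simp add: linear_form_def sum_distrib_right Var_def scale_mpoly_single mult_single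
        apolar_def linear_ext_sum linear_ext_single)
  finally show ?thesis .
qed

lemma derivative_vectors_lin_indep_iff:
  fixes G :: "nat \<Rightarrow> ('v::finite, 'a::field_char_0) mpoly"
  assumes "S \<subseteq> forms (Suc e)"
    and G: "mpoly_space.span (G ` {0..N}) = inverse_system (ideal_generated S) \<inter> forms (Suc e)"
  shows "lin_indep_family fscale {\<alpha>. mdeg \<alpha> = e} (\<lambda>\<alpha>. derivative_vector N G \<alpha> x) \<longleftrightarrow>
    (\<forall>f\<in>forms e. linear_form x * f \<in> mpoly_space.span S \<longrightarrow> f = 0)"
proof -
  define form where "form c = (\<Sum>\<alpha> | mdeg \<alpha> = e. scale_mpoly (c \<alpha>) (Poly_Mapping.single \<alpha> 1))"
    for c :: "('v \<Rightarrow>\<^sub>0 nat) \<Rightarrow> 'a"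
  have form: "form c \<in> forms e" for c
    unfolding form_def by (intro forms_sum forms_scale single_in_forms) auto
  have Gi: "G i \<in> forms (Suc e)" if "i \<le> N" for i
    using that mpoly_space.span_base[of "G i" "G ` {0..N}"] unfolding G by simp
  \<comment> \<open>Coefficient families are read as forms of degree \<open>e\<close>: the entry
    \<open>i\<close> of the combination of derivative vectors is a pairing with \<open>G i\<close>,
    and entries beyond \<open>N\<close> are 0.\<close>
  have rel: "(\<Sum>\<alpha> | mdeg \<alpha> = e. c \<alpha> * derivative_vector N G \<alpha> x i) =
      (if i \<le> N then apolar (linear_form x * form c) (G i) else 0)" for c i
    by (auto simp: derivative_vector_def form_def sum_distrib_left apolar_sum_left
        mult_scale_mpoly_right apolar_scale_left eval_pdiffs_eq_apolar Gi intro!: sum.cong)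
  have "(\<forall>i. (\<Sum>\<alpha> | mdeg \<alpha> = e. c \<alpha> * derivative_vector N G \<alpha> x i) = 0) \<longleftrightarrow>
      linear_form x * form c \<in> mpoly_space.span S" for c
  proof
    assume "\<forall>i. (\<Sum>\<alpha> | mdeg \<alpha> = e. c \<alpha> * derivative_vector N G \<alpha> x i) = 0"
    then have 0: "apolar (linear_form x * form c) p = 0" if "p \<in> G ` {0..N}" for p
      using that unfolding rel by (metis atLeastAtMost_iff imageE)
    \<comment> \<open>The \<open>G i\<close> span the annihilator of \<open>S\<close> among the
      forms of degree \<open>Suc e\<close>, so an annihilator of all \<open>G i\<close> lies in the
      span of \<open>S\<close>.\<close>
    show "linear_form x * form c \<in> mpoly_space.span S"
    proof (rule in_span_if_annihilated[OF _ assms(1)])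
      show "linear_form x * form c \<in> forms (Suc e)"
        using forms_mult[OF linear_form_in_forms form] by simp
      show "apolar (linear_form x * form c) p = 0"
        if "p \<in> forms (Suc e)" "\<forall>w\<in>S. apolar w p = 0" for p
      proof (rule apolar_span_right[OF 0])
        show "p \<in> mpoly_space.span (G ` {0..N})"
          using that unfolding G inverse_system_ideal_generated[OF assms(1)] by simp
      qed
    qed
  next
    assume span: "linear_form x * form c \<in> mpoly_space.span S"
    have "apolar (linear_form x * form c) (G i) = 0" if "i \<le> N" for i
    proof -
      have "G i \<in> mpoly_space.span (G ` {0..N})"
        using that by (intro mpoly_space.span_base) auto
      then have "\<forall>w\<in>S. apolar w (G i) = 0"
        unfolding G inverse_system_ideal_generated[OF assms(1)] by blast
      then show ?thesis by (intro apolar_span_left[OF _ span]) simp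
    qed
    then show "\<forall>i. (\<Sum>\<alpha> | mdeg \<alpha> = e. c \<alpha> * derivative_vector N G \<alpha> x i) = 0"
      unfolding rel by simp
  qed
  then have "lin_indep_family fscale {\<alpha>. mdeg \<alpha> = e} (\<lambda>\<alpha>. derivative_vector N G \<alpha> x) \<longleftrightarrow>
      (\<forall>c. linear_form x * form c \<in> mpoly_space.span S \<longrightarrow> (\<forall>\<alpha>\<in>{\<alpha>. mdeg \<alpha> = e}. c \<alpha> = 0))"
    unfolding lin_indep_family_fscale_iff by blast
  also have "\<dots> \<longleftrightarrow> (\<forall>c. linear_form x * form c \<in> mpoly_space.span S \<longrightarrow> form c = 0)"
  proof -
    have "form c = 0 \<longleftrightarrow> (\<forall>\<alpha>\<in>{\<alpha>. mdeg \<alpha> = e}. c \<alpha> = 0)" for c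
      using lin_indep_monomials[of e, where 'v = 'v and 'a = 'a]
      unfolding lin_indep_family_def form_def by (auto intro!: sum.neutral)
    then show ?thesis by simp
  qed
  also have "\<dots> \<longleftrightarrow> (\<forall>f\<in>forms e. linear_form x * f \<in> mpoly_space.span S \<longrightarrow> f = 0)"
  proof (intro iffI allI ballI impI)
    fix f assume *: "\<forall>c. linear_form x * form c \<in> mpoly_space.span S \<longrightarrow> form c = 0"
      and f: "f \<in> forms e" "linear_form x * f \<in> mpoly_space.span S"
    have "f = form (Poly_Mapping.lookup f)"
      unfolding form_def by (rule forms_eq_sum[OF f(1)])
    then show "f = 0" using * f(2) by metis
  qed (use form in blast)
  finally show ?thesis .
qed

section \<open>General points\<close>

lemma for_generalI:
  fixes f :: "('v::finite, 'a::field) mpoly"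
  assumes "f \<in> forms k" and "x \<noteq> 0" and "eval x f \<noteq> 0"
    and "\<And>y. y \<noteq> 0 \<Longrightarrow> eval y f \<noteq> 0 \<Longrightarrow> P y"
  shows "for_general P"
  unfolding for_general_def
proof (intro exI conjI)
  show "zariski_open {y. y \<noteq> 0 \<and> eval y f \<noteq> 0}"
    unfolding zariski_open_def using assms(1) by (intro exI[of _ "{f}"]) auto
  show "{y. y \<noteq> 0 \<and> eval y f \<noteq> 0} \<noteq> {}" using assms by blast
  show "\<forall>y\<in>{y. y \<noteq> 0 \<and> eval y f \<noteq> 0}. P y" using assms by blast
qed

lemma for_generalE:
  fixes P :: "('v::finite \<Rightarrow> 'a::field) \<Rightarrow> bool"
  assumes "for_general P"
  obtains f :: "('v, 'a) mpoly" and x where "x \<noteq> 0" "eval x f \<noteq> 0"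
    "\<And>y. y \<noteq> 0 \<Longrightarrow> eval y f \<noteq> 0 \<Longrightarrow> P y"
proof -
  obtain U where U: "zariski_open U" "U \<noteq> {}" "\<forall>x\<in>U. P x"
    using assms unfolding for_general_def by blast
  obtain S :: "('v, 'a) mpoly set" where S: "U = {x. x \<noteq> 0 \<and> (\<exists>f\<in>S. eval x f \<noteq> 0)}"
    using U(1) unfolding zariski_open_def by blast
  obtain x f where xf: "x \<noteq> 0" "f \<in> S" "eval x f \<noteq> 0" using U(2) unfolding S by blast
  show ?thesis by (rule that[OF xf(1,3)]) (use U(3) xf(2) S in blast)
qed

lemma for_general_mono:
  assumes "for_general P" and "\<And>x. x \<noteq> 0 \<Longrightarrow> P x \<Longrightarrow> Q x"
  shows "for_general Q"
proof -
  obtain U where U: "zariski_open U" "U \<noteq> {}" "\<forall>x\<in>U. P x"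
    using assms(1) unfolding for_general_def by blast
  moreover have "\<forall>x\<in>U. x \<noteq> 0" using U(1) unfolding zariski_open_def by blast
  ultimately show ?thesis unfolding for_general_def using assms(2) by blast
qed

lemma for_general_cong:
  assumes "\<And>x. x \<noteq> 0 \<Longrightarrow> P x \<longleftrightarrow> Q x"
  shows "for_general P \<longleftrightarrow> for_general Q"
  using assms for_general_mono by metis

text \<open>Irreducibility of projective space: two nonempty open sets meet.\<close>

lemma for_general_common_point:
  fixes P Q :: "('v::finite \<Rightarrow> 'a::field_char_0) \<Rightarrow> bool"
  assumes "for_general P" and "for_general Q"
  obtains x where "x \<noteq> 0" "P x" "Q x"
proof -
  obtain f :: "('v, 'a) mpoly" and x where f: "eval x f \<noteq> 0"
    "\<And>y. y \<noteq> 0 \<Longrightarrow> eval y f \<noteq> 0 \<Longrightarrow> P y"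
    using for_generalE[OF assms(1)] by metis
  obtain g :: "('v, 'a) mpoly" and y where g: "y \<noteq> 0" "eval y g \<noteq> 0"
    "\<And>y. y \<noteq> 0 \<Longrightarrow> eval y g \<noteq> 0 \<Longrightarrow> Q y"
    using for_generalE[OF assms(2)] by metis
  \<comment> \<open>The extra factor \<open>Var v\<close> keeps the common point away from the zero
    vector, which is not a point of projective space.\<close>
  obtain v where "y v \<noteq> 0" using g(1) by (auto simp: fun_eq_iff)
  then have "eval y (g * Var v) \<noteq> 0" using g(2) by (simp add: eval_mult eval_Var)
  then obtain z where z: "eval z f \<noteq> 0" "eval z (g * Var v) \<noteq> 0"
    using common_nonzero f(1) by blast
  then have "z \<noteq> 0" "eval z g \<noteq> 0" by (auto simp: eval_mult eval_Var)
  then show ?thesis using that f(2) g(3) z(1) by blast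
qed

text \<open>Gaussian elimination without division: after clearing the column \<open>j\<close> with the pivot
  \<open>v a j\<close>, the entries are again forms of one common degree.\<close>

lemma lin_indep_family_open:
  fixes v :: "'i \<Rightarrow> 'j \<Rightarrow> ('v::finite, 'a::field) mpoly"
  assumes "finite A" and "\<And>i j. i \<in> A \<Longrightarrow> v i j \<in> forms e"
    and "lin_indep_family fscale A (\<lambda>i j. eval x (v i j))"
  shows "\<exists>f k. f \<in> forms k \<and> eval x f \<noteq> 0 \<and>
    (\<forall>y. eval y f \<noteq> 0 \<longrightarrow> lin_indep_family fscale A (\<lambda>i j. eval y (v i j)))"
  using assms
proof (induction A arbitrary: v e rule: finite_induct)
  case empty
  have "(1 :: ('v, 'a) mpoly) \<in> forms 0" by (simp add: forms_def)
  then show ?case by (intro exI[of _ 1] exI[of _ 0]) (auto simp: lin_indep_family_def)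
next
  case (insert a A)
  note indep = insert.prems(2)[unfolded lin_indep_family_fscale_iff, rule_format]
  have "\<exists>j. eval x (v a j) \<noteq> 0"
  proof (rule ccontr)
    assume "\<nexists>j. eval x (v a j) \<noteq> 0"
    then have "(\<Sum>i\<in>insert a A. (if i = a then 1 else 0) * eval x (v i j)) = 0" for j
      by (intro sum.neutral) auto
    from indep[OF this, of a] show False by simp
  qed
  then obtain j where j: "eval x (v a j) \<noteq> 0" by blast
  define w where "w i l = v a j * v i l - v i j * v a l" for i l
  have w_eval: "eval y (w i l) = eval y (v a j) * eval y (v i l) - eval y (v i j) * eval y (v a l)" for y i l
    by (simp add: w_def eval_diff eval_mult)
  have w_sum: "(\<Sum>i\<in>A. c i * eval y (w i l)) = eval y (v a j) * (\<Sum>i\<in>A. c i * eval y (v i l)) -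
      eval y (v a l) * (\<Sum>i\<in>A. c i * eval y (v i j))" for c y l
    by (simp add: w_eval sum_distrib_left sum_subtractf algebra_simps)
  have "w i l \<in> forms (e + e)" if "i \<in> A" for i l
    unfolding w_def using that insert.prems(1) by (intro forms_diff forms_mult) auto
  moreover have "lin_indep_family fscale A (\<lambda>i l. eval x (w i l))"
    unfolding lin_indep_family_fscale_iff
  proof (intro allI impI ballI)
    fix c i assume 0: "\<forall>l. (\<Sum>i\<in>A. c i * eval x (w i l)) = 0" and i: "i \<in> A"
    \<comment> \<open>A relation among the \<open>w i\<close> expands to one among the
      \<open>v i\<close>: the subtracted terms collect at the index \<open>a\<close>, and the other
      coefficients are multiplied by the pivot, which is nonzero at \<open>x\<close>.\<close>
    define b where "b i = (if i = a then - (\<Sum>i\<in>A. c i * eval x (v i j)) else c i * eval x (v a j))" for i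
    have "(\<Sum>i\<in>insert a A. b i * eval x (v i l)) = 0" for l
    proof -
      have "(\<Sum>i\<in>A. b i * eval x (v i l)) = eval x (v a j) * (\<Sum>i\<in>A. c i * eval x (v i l))"
        unfolding sum_distrib_left using insert.hyps by (intro sum.cong) (auto simp: b_def)
      then show ?thesis
        using insert.hyps 0[rule_format, of l] unfolding w_sum by (simp add: b_def algebra_simps)
    qed
    from indep[OF this, of i] have "b i = 0" using i by simp
    moreover have "i \<noteq> a" using i insert.hyps by blast
    ultimately show "c i = 0" using j by (simp add: b_def)
  qed
  ultimately obtain f k where f: "f \<in> forms k" "eval x f \<noteq> 0"
    "\<And>y. eval y f \<noteq> 0 \<Longrightarrow> lin_indep_family fscale A (\<lambda>i l. eval y (w i l))"
    using insert.IH[of w "e + e"] by blast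
  show ?case
  proof (intro exI conjI allI impI)
    show "f * v a j \<in> forms (k + e)"
      using f(1) insert.prems(1) by (intro forms_mult) auto
    show "eval x (f * v a j) \<noteq> 0" using f(2) j by (simp add: eval_mult)
    fix y assume y: "eval y (f * v a j) \<noteq> 0"
    show "lin_indep_family fscale (insert a A) (\<lambda>i l. eval y (v i l))"
      unfolding lin_indep_family_fscale_iff
    proof (intro allI impI)
      fix c assume 0: "\<forall>l. (\<Sum>i\<in>insert a A. c i * eval y (v i l)) = 0"
      have S: "(\<Sum>i\<in>A. c i * eval y (v i l)) = - (c a * eval y (v a l))" for l
        using 0[rule_format, of l] insert.hyps by (simp add: add_eq_0_iff)
      have "(\<Sum>i\<in>A. c i * eval y (w i l)) = 0" for l
        unfolding w_sum S by simp
      then have cA: "\<forall>i\<in>A. c i = 0"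
        using f(3)[of y] y unfolding lin_indep_family_fscale_iff by (auto simp: eval_mult)
      then have "c a * eval y (v a j) = 0" using S[of j] by simp
      then show "\<forall>i\<in>insert a A. c i = 0" using cA y by (simp add: eval_mult)
    qed
  qed
qed

section \<open>Multiplication by a linear form\<close>

lemma residue_class_eq_iff:
  assumes "is_ideal I"
  shows "residue_class I f = residue_class I g \<longleftrightarrow> f - g \<in> I"
proof
  have I: "mpoly_module.subspace I" using assms by (simp add: is_ideal_def)
  show "f - g \<in> I" if "residue_class I f = residue_class I g"
  proof -
    have "f \<in> residue_class I f"
      using mpoly_module.subspace_0[OF I] by (simp add: residue_class_def)
    then show ?thesis unfolding that by (simp add: residue_class_def)
  qed
  show "residue_class I f = residue_class I g" if fg: "f - g \<in> I"
    unfolding residue_class_def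
  proof (intro Collect_cong iffI)
    fix h
    show "h - g \<in> I" if "h - f \<in> I"
      using mpoly_module.subspace_add[OF I that fg] by simp
    show "h - f \<in> I" if "h - g \<in> I"
      using mpoly_module.subspace_diff[OF I that fg] by simp
  qed
qed

text \<open>The ideal is zero in degree \<open>e\<close> and equals the span of \<open>S\<close> in
  degree \<open>Suc e\<close>. By linearity it is enough to look at the kernel.\<close>

lemma inj_on_mult_class_iff:
  assumes "S \<subseteq> forms (Suc e)"
  shows "inj_on (mult_class (ideal_generated S) (linear_form a)) (quotient_part (ideal_generated S) e) \<longleftrightarrow>
    (\<forall>f\<in>forms e. linear_form a * f \<in> mpoly_space.span S \<longrightarrow> f = 0)"
proof -
  let ?I = "ideal_generated S"
  note I = is_ideal_ideal_generated[of S]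
  have 0: "0 \<in> ?I"
    using I mpoly_module.subspace_0 unfolding is_ideal_def by blast
  have low: "f \<in> ?I \<longleftrightarrow> f = 0" if "f \<in> forms e" for f
    using ideal_generated_lower_degree[OF assms, of e f] that 0 by auto
  have "linear_form a * f \<in> ?I \<longleftrightarrow> linear_form a * f \<in> mpoly_space.span S" if "f \<in> forms e" for f
    using forms_mult[OF linear_form_in_forms that, of a] unfolding ideal_generated_same_degree[OF assms, symmetric]
    by simp
  moreover have "inj_on (mult_class ?I (linear_form a)) (quotient_part ?I e) \<longleftrightarrow>
      (\<forall>f\<in>forms e. \<forall>g\<in>forms e. linear_form a * f - linear_form a * g \<in> ?I \<longrightarrow> f - g \<in> ?I)"
    unfolding inj_on_def quotient_part_def
    by (simp add: mult_class_residue_class[OF I] residue_class_eq_iff[OF I])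
  moreover have "\<dots> \<longleftrightarrow> (\<forall>f\<in>forms e. linear_form a * f \<in> ?I \<longrightarrow> f \<in> ?I)"
  proof (intro iffI ballI impI)
    fix f g assume "\<forall>f\<in>forms e. linear_form a * f \<in> ?I \<longrightarrow> f \<in> ?I" "f \<in> forms e" "g \<in> forms e"
      "linear_form a * f - linear_form a * g \<in> ?I"
    then show "f - g \<in> ?I" using forms_diff[of f e g] by (simp add: right_diff_distrib)
  next
    fix f assume "\<forall>f\<in>forms e. \<forall>g\<in>forms e. linear_form a * f - linear_form a * g \<in> ?I \<longrightarrow> f - g \<in> ?I"
      "f \<in> forms e" "linear_form a * f \<in> ?I"
    then show "f \<in> ?I" by (metis diff_zero forms_0 mult_zero_right)
  qed
  ultimately show ?thesis using low by auto
qed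

text \<open>A relation among the restrictions is a combination of the \<open>F i\<close> that
  vanishes on the hyperplane, i.e. a multiple of the linear form. Independence of the
  \<open>F i\<close> and the absence of zero divisors make nontrivial relations correspond to
  nonzero cofactors \<open>f\<close>.\<close>

lemma restrictions_dependent_iff:
  fixes F :: "'i \<Rightarrow> ('v::finite, 'a::field_char_0) mpoly"
  assumes "finite A" and "\<And>i. i \<in> A \<Longrightarrow> F i \<in> forms (Suc e)"
    and "lin_indep_family scale_mpoly A F" and "a \<noteq> 0"
  shows "lin_indep_family fscale A (\<lambda>i. restriction (hyperplane a) (F i)) \<longleftrightarrow>
    (\<forall>f\<in>forms e. linear_form a * f \<in> mpoly_space.span (F ` A) \<longrightarrow> f = 0)"
proof -
  have res: "(\<Sum>i\<in>A. c i * restriction (hyperplane a) (F i) x) =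
      (if x \<in> hyperplane a then eval x (\<Sum>i\<in>A. scale_mpoly (c i) (F i)) else 0)" for c x
    by (simp add: restriction_def eval_sum eval_scale)
  show ?thesis
  proof
    assume L: "lin_indep_family fscale A (\<lambda>i. restriction (hyperplane a) (F i))"
    show "\<forall>f\<in>forms e. linear_form a * f \<in> mpoly_space.span (F ` A) \<longrightarrow> f = 0"
    proof (intro ballI impI)
      fix f assume "linear_form a * f \<in> mpoly_space.span (F ` A)"
      then obtain c where c: "linear_form a * f = (\<Sum>i\<in>A. scale_mpoly (c i) (F i))"
        using mpoly_space.in_span_family_iff[OF assms(1)] by metis
      have "(\<Sum>i\<in>A. c i * restriction (hyperplane a) (F i) x) = 0" for x
        unfolding res c[symmetric] by (simp add: eval_mult hyperplane_def)
      then have "\<forall>i\<in>A. c i = 0"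
        using L unfolding lin_indep_family_fscale_iff by blast
      then have "linear_form a * f = 0" unfolding c by simp
      then show "f = 0" using mult_neq_0[OF linear_form_neq_0[OF assms(4)]] by blast
    qed
  next
    assume R: "\<forall>f\<in>forms e. linear_form a * f \<in> mpoly_space.span (F ` A) \<longrightarrow> f = 0"
    show "lin_indep_family fscale A (\<lambda>i. restriction (hyperplane a) (F i))"
      unfolding lin_indep_family_fscale_iff
    proof (intro allI impI)
      fix c assume 0: "\<forall>x. (\<Sum>i\<in>A. c i * restriction (hyperplane a) (F i) x) = 0"
      define p where "p = (\<Sum>i\<in>A. scale_mpoly (c i) (F i))"
      have "p \<in> forms (Suc e)"
        unfolding p_def using assms(2) by (intro forms_sum forms_scale)
      moreover have "eval x p = 0" if "x \<in> hyperplane a" for x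
        using 0 that unfolding res p_def by metis
      ultimately obtain f where f: "f \<in> forms e" "p = linear_form a * f"
        using linear_form_dvd_if_vanishing[OF assms(4)] by blast
      have "p \<in> mpoly_space.span (F ` A)"
        unfolding mpoly_space.in_span_family_iff[OF assms(1)] p_def by blast
      then have "p = 0" using R f by auto
      then show "\<forall>i\<in>A. c i = 0"
        using assms(3) unfolding lin_indep_family_def p_def by blast
    qed
  qed
qed

text \<open>Pascal's rule, read as follows: in \<open>n + 1\<close> variables, the dimensions of the
  forms of degree \<open>Suc e\<close> and \<open>e\<close> differ by exactly the bound imposed on
  the number of generators.\<close>

lemma choose_Suc_split:
  assumes "n \<ge> 1"
  shows "(n + Suc e) choose (Suc e) = ((n + e) choose e) + ((n + e) choose (n - 1))"
proof -
  have "(n + e) choose (n - 1) = (n + e) choose (Suc e)"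
    using assms binomial_symmetric[of "n - 1" "n + e"] by simp
  then show ?thesis by simp
qed

text \<open>The form \<open>linear_form a * f\<close> in the span of the \<open>F i\<close> makes one of the \<open>F i\<close> redundant, so that
  the image of the multiplication map is too small.\<close>

lemma not_surj_mult_class:
  fixes F :: "'i \<Rightarrow> ('v::finite, 'a::field_char_0) mpoly"
  assumes card: "CARD('v) = n + 1" "n \<ge> 1" and A: "finite A" "card A \<le> (n + e) choose (n - 1)"
    and F: "\<And>i. i \<in> A \<Longrightarrow> F i \<in> forms (Suc e)" and "a \<noteq> 0"
    and f: "f \<in> forms e" "f \<noteq> 0" "linear_form a * f \<in> mpoly_space.span (F ` A)"
  shows "mult_class (ideal_generated (F ` A)) (linear_form a) ` quotient_part (ideal_generated (F ` A)) e \<noteq>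
    quotient_part (ideal_generated (F ` A)) (Suc e)"
proof
  let ?I = "ideal_generated (F ` A)"
  note I = is_ideal_ideal_generated[of "F ` A"]
  assume surj: "mult_class ?I (linear_form a) ` quotient_part ?I e = quotient_part ?I (Suc e)"
  have FA: "F ` A \<subseteq> forms (Suc e)" using F by blast
  obtain c where c: "linear_form a * f = (\<Sum>i\<in>A. scale_mpoly (c i) (F i))"
    using f(3) mpoly_space.in_span_family_iff[OF A(1)] by metis
  have "linear_form a * f \<noteq> 0"
    using mult_neq_0[OF linear_form_neq_0[OF assms(6)] f(2)] .
  then obtain j where j: "j \<in> A" "c j \<noteq> 0"
    unfolding c by (metis (no_types, lifting) mpoly_space.scale_zero_left sum.neutral)
  define M where "M = {m :: 'v \<Rightarrow>\<^sub>0 nat. mdeg m = e}"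
  \<comment> \<open>Spans all multiples of the linear form and all \<open>F i\<close> in degree
    \<open>Suc e\<close>, although \<open>F j\<close> is left out.\<close>
  define W where "W = (\<lambda>m. linear_form a * Poly_Mapping.single m 1) ` M \<union> F ` (A - {j})"
  have M: "finite M" "card M = (n + e) choose e"
    using card(1) by (simp_all add: M_def finite_card_mdeg)
  have mult: "linear_form a * g \<in> mpoly_space.span W" if "g \<in> forms e" for g
  proof -
    have "linear_form a * g = (\<Sum>m\<in>M. scale_mpoly (Poly_Mapping.lookup g m)
        (linear_form a * Poly_Mapping.single m 1))"
      by (subst forms_eq_sum[OF that]) (simp add: sum_distrib_left mult_scale_mpoly_right M_def)
    also have "\<dots> \<in> mpoly_space.span W"
      by (intro mpoly_space.span_sum mpoly_space.span_scale mpoly_space.span_base) (auto simp: W_def)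
    finally show ?thesis .
  qed
  have "F j \<in> mpoly_space.span (insert (linear_form a * f) (F ` (A - {j})))"
    unfolding c using A(1) j by (rule mpoly_space.family_exchange)
  moreover have "mpoly_space.span (insert (linear_form a * f) (F ` (A - {j}))) \<subseteq> mpoly_space.span W"
  proof (intro mpoly_space.span_minimal mpoly_space.subspace_span insert_subsetI mult f(1))
    show "F ` (A - {j}) \<subseteq> mpoly_space.span W"
      using mpoly_space.span_superset[of W] by (auto simp: W_def)
  qed
  ultimately have Fj: "F j \<in> mpoly_space.span W" by blast
  have "F ` A \<subseteq> mpoly_space.span W"
  proof (intro image_subsetI)
    show "F i \<in> mpoly_space.span W" if "i \<in> A" for i
      using Fj that mpoly_space.span_superset[of W] by (cases "i = j") (auto simp: W_def)
  qed
  then have span: "mpoly_space.span (F ` A) \<subseteq> mpoly_space.span W"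
    by (intro mpoly_space.span_minimal mpoly_space.subspace_span)
  \<comment> \<open>Surjectivity writes every form of degree \<open>Suc e\<close> as a multiple of
    the linear form plus an element of the ideal.\<close>
  have "forms (Suc e) \<subseteq> mpoly_space.span W"
  proof
    fix p :: "('v, 'a) mpoly" assume p: "p \<in> forms (Suc e)"
    then have "residue_class ?I p \<in> mult_class ?I (linear_form a) ` quotient_part ?I e"
      unfolding surj by (auto simp: quotient_part_def)
    then obtain g where g: "g \<in> forms e" "residue_class ?I p = residue_class ?I (linear_form a * g)"
      by (auto simp: quotient_part_def mult_class_residue_class[OF I])
    have "p - linear_form a * g \<in> ?I \<inter> forms (Suc e)"
      using g p forms_mult[OF linear_form_in_forms g(1), of a]
      by (simp add: residue_class_eq_iff[OF I] forms_diff)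
    then have "p - linear_form a * g \<in> mpoly_space.span W"
      unfolding ideal_generated_same_degree[OF FA] using span by blast
    from mpoly_space.span_add[OF this mult[OF g(1)]] show "p \<in> mpoly_space.span W" by simp
  qed
  then have "mpoly_space.dim (forms (Suc e) :: ('v, 'a) mpoly set) \<le> card W"
    using M(1) A(1) by (intro mpoly_space.dim_le_card) (auto simp: W_def)
  also have "card W \<le> card M + card (A - {j})"
    unfolding W_def
    by (intro order.trans[OF card_Un_le] add_mono card_image_le) (use M A in auto)
  \<comment> \<open>The missing index \<open>j\<close> makes the inequality strict, which is what
    contradicts the dimension of the forms.\<close>
  also have "\<dots> < card M + card A"
    using card_Diff1_less[OF A(1) j(1)] by simp
  also have "\<dots> \<le> (n + Suc e) choose Suc e"
    using A(2) M(2) choose_Suc_split[OF card(2)] by simp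
  finally show False using card(1) by (simp add: dim_forms)
qed

section \<open>Osculating spaces\<close>

lemma osculating_cone_eq_span_family:
  "osculating_cone N G e x = fun_space.span ((\<lambda>\<alpha>. derivative_vector N G \<alpha> x) ` {\<alpha>. mdeg \<alpha> = e})"
  unfolding osculating_cone_def by (intro arg_cong[where f = fun_space.span]) auto

text \<open>The general dimension is the maximal one. Derivative vectors forming a basis at a point
  of maximal dimension stay independent on an open set, where the dimension can then neither drop
  nor grow.\<close>

lemma osculating_cone_dim_general:
  fixes G :: "nat \<Rightarrow> ('v::finite, 'a::field_char_0) mpoly"
  assumes G: "\<And>i. i \<le> N \<Longrightarrow> G i \<in> forms (Suc e)"
  obtains m where "for_general (\<lambda>x. fun_space.dim (osculating_cone N G e x) = m)"
proof -
  let ?A = "{\<alpha> :: 'v \<Rightarrow>\<^sub>0 nat. mdeg \<alpha> = e}"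
  let ?dim = "\<lambda>x. fun_space.dim (osculating_cone N G e x)"
  have A: "finite ?A" by (rule finite_card_mdeg)
  \<comment> \<open>Presents the derivative vectors as the values of a matrix of linear forms,
    padded by 0 beyond \<open>N\<close>.\<close>
  define D where "D \<alpha> i = (if i \<le> N then pdiffs \<alpha> (G i) else 0)" for \<alpha> i
  have D: "derivative_vector N G \<alpha> x = (\<lambda>i. eval x (D \<alpha> i))" for \<alpha> x
    by (auto simp: derivative_vector_def D_def)
  have le: "?dim x \<le> card ?A" for x
    unfolding osculating_cone_eq_span_family by (rule fun_space.dim_span_family_le[OF A])
  define m where "m = Max (?dim ` {x. x \<noteq> 0})"
  have fin: "finite (?dim ` {x. x \<noteq> 0})"
    using le by (intro finite_subset[OF _ finite_atMost[of "card ?A"]]) auto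
  have "(\<lambda>_. 1) \<in> {x :: 'v \<Rightarrow> 'a. x \<noteq> 0}" by (auto simp: fun_eq_iff)
  then have "m \<in> ?dim ` {x. x \<noteq> 0}"
    unfolding m_def using fin by (intro Max_in) auto
  then obtain x where x: "x \<noteq> 0" "?dim x = m" by auto
  obtain B where B: "B \<subseteq> ?A" "lin_indep_family fscale B (\<lambda>\<alpha>. derivative_vector N G \<alpha> x)"
    "card B = ?dim x"
    unfolding osculating_cone_eq_span_family by (rule fun_space.exists_subfamily_basis[OF A])
  have "D \<alpha> i \<in> forms 1" if "\<alpha> \<in> B" for \<alpha> i
    using that B(1) G by (auto simp: D_def intro!: pdiffs_in_forms)
  then obtain f k where f: "f \<in> forms k" "eval x f \<noteq> 0"
    "\<And>y. eval y f \<noteq> 0 \<Longrightarrow> lin_indep_family fscale B (\<lambda>\<alpha>. derivative_vector N G \<alpha> y)"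
    using lin_indep_family_open[OF finite_subset[OF B(1) A], of D 1 x] B(2) unfolding D by blast
  have "?dim y = m" if "y \<noteq> 0" "eval y f \<noteq> 0" for y
  proof (rule antisym)
    show "?dim y \<le> m" unfolding m_def using fin that by (intro Max_ge) auto
    show "m \<le> ?dim y"
      using fun_space.card_lin_indep_subfamily_le[OF A B(1) f(3)[OF that(2)]] B(3) x(2)
      unfolding osculating_cone_eq_span_family by simp
  qed
  then have "for_general (\<lambda>x. ?dim x = m)"
    using for_generalI[OF f(1) x(1) f(2), of "\<lambda>x. ?dim x = m"] by blast
  then show ?thesis by (rule that)
qed

theorem theorem3p2:
  fixes n d r N :: nat
    and F G :: "nat \<Rightarrow> ('v::finite, 'a::{alg_closed_field, field_char_0}) mpoly"
    and I :: "('v, 'a) mpoly set"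
  assumes "CARD('v) = n + 1" and "n \<ge> 1" and "d \<ge> 1"
    and "\<forall>i\<in>{1..r}. F i \<in> forms d"
    and "lin_indep_family scale_mpoly {1..r} F"
    and "I = ideal_generated (F ` {1..r})"
    and "artinian_ideal I"
    and "r \<le> (n + d - 1) choose (n - 1)"
    and "N + r + 1 = (n + d) choose d"
    and "is_basis_family {0..N} G (inverse_system I \<inter> forms d)"
  shows "(fails_WLP I (d - 1) \<longleftrightarrow> dependent_on_general_hyperplane {1..r} F) \<and>
    (dependent_on_general_hyperplane {1..r} F \<longleftrightarrow>
      (\<exists>\<delta>\<ge>1. satisfies_Laplace_equations N G (d - 1) \<delta>))"
proof -
  obtain e where d: "d = Suc e" using assms(3) by (cases d) auto
  have F: "F i \<in> forms (Suc e)" if "i \<in> {1..r}" for i using assms(4) d that by blast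
  then have FA: "F ` {1..r} \<subseteq> forms (Suc e)" by blast
  have G: "mpoly_space.span (G ` {0..N}) = inverse_system (ideal_generated (F ` {1..r})) \<inter> forms (Suc e)"
    using assms(6,10) by (simp add: is_basis_family_def d)
  define K where "K a \<longleftrightarrow> (\<exists>f\<in>forms e. f \<noteq> 0 \<and> linear_form a * f \<in> mpoly_space.span (F ` {1..r}))" for a
  have dep: "\<not> lin_indep_family fscale {1..r} (\<lambda>i. restriction (hyperplane a) (F i)) \<longleftrightarrow> K a"
    if "a \<noteq> 0" for a
    using restrictions_dependent_iff[of "{1..r}" F e a, OF _ F assms(5) that] unfolding K_def by auto
  \<comment> \<open>By the bound on \<open>r\<close>, a nonzero kernel also excludes surjectivity,
    so failure of maximal rank comes down to \<open>K a\<close>.\<close>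
  have wlp: "\<not> inj_on (mult_class I (linear_form a)) (quotient_part I e) \<and>
      mult_class I (linear_form a) ` quotient_part I e \<noteq> quotient_part I (e + 1) \<longleftrightarrow> K a"
    if "a \<noteq> 0" for a
  proof -
    have "\<not> inj_on (mult_class I (linear_form a)) (quotient_part I e) \<longleftrightarrow> K a"
      unfolding assms(6) inj_on_mult_class_iff[OF FA] K_def by blast
    moreover have "mult_class I (linear_form a) ` quotient_part I e \<noteq> quotient_part I (e + 1)" if K: "K a"
    proof -
      obtain f where "f \<in> forms e" "f \<noteq> 0" "linear_form a * f \<in> mpoly_space.span (F ` {1..r})"
        using K unfolding K_def by blast
      then show ?thesis
        using not_surj_mult_class[of n "{1..r}" e F a f] F assms(1,2,8) \<open>a \<noteq> 0\<close>
        unfolding assms(6) d by simp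
    qed
    ultimately show ?thesis by blast
  qed
  have 12: "fails_WLP I (d - 1) \<longleftrightarrow> for_general K" "dependent_on_general_hyperplane {1..r} F \<longleftrightarrow> for_general K"
    unfolding fails_WLP_def dependent_on_general_hyperplane_def
    using for_general_cong[OF wlp] for_general_cong[OF dep] by (simp_all add: d)

  \<comment> \<open>Osculating dimension and Laplace equations\<close>
  let ?dim = "\<lambda>x. fun_space.dim (osculating_cone N G e x)"
  let ?M = "(n + e) choose e"
  have finM: "finite {\<alpha> :: 'v \<Rightarrow>\<^sub>0 nat. mdeg \<alpha> = e}" and cardM: "card {\<alpha> :: 'v \<Rightarrow>\<^sub>0 nat. mdeg \<alpha> = e} = ?M"
    using finite_card_mdeg[where 'v = 'v, of e] assms(1) by simp_all
  have dim_le: "?dim x \<le> ?M" for x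
    unfolding osculating_cone_eq_span_family
    using fun_space.dim_span_family_le[OF finM, of "\<lambda>\<alpha>. derivative_vector N G \<alpha> x"] by (simp only: cardM)
  have "?dim x = ?M \<longleftrightarrow> \<not> K x" for x
    unfolding osculating_cone_eq_span_family cardM[symmetric] fun_space.dim_span_family_eq_iff[OF finM]
      derivative_vectors_lin_indep_iff[OF FA G] K_def by blast
  then have dim_less: "?dim x < ?M \<longleftrightarrow> K x" for x
    using dim_le[of x] by (metis le_neq_implies_less less_irrefl)
  \<comment> \<open>The shifts by 1 from affine cones to projective dimensions cancel.\<close>
  have laplace: "satisfies_Laplace_equations N G (d - 1) \<delta> \<longleftrightarrow>
      for_general (\<lambda>x. int (?dim x) = int ?M - int \<delta>)" for \<delta>
    by (simp add: satisfies_Laplace_equations_def osculating_dim_def d assms(1) algebra_simps)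
  have "for_general K \<longleftrightarrow> (\<exists>\<delta>\<ge>1. satisfies_Laplace_equations N G (d - 1) \<delta>)"
  proof
    assume K: "for_general K"
    have Gi: "G i \<in> forms (Suc e)" if "i \<le> N" for i
      using that mpoly_space.span_base[of "G i" "G ` {0..N}"] unfolding G by simp
    obtain m where m: "for_general (\<lambda>x. ?dim x = m)"
      using osculating_cone_dim_general[of N G, OF Gi] by blast
    \<comment> \<open>A point that is general for both properties shows that the general dimension
      \<open>m\<close> is below the expected one; \<open>\<delta>\<close> is then the positive
      defect \<open>?M - m\<close>.\<close>
    obtain x where "K x" "?dim x = m"
      using for_general_common_point[OF K m] by blast
    then have "m < ?M" using dim_less by blast
    moreover from this have "satisfies_Laplace_equations N G (d - 1) (?M - m)"
      unfolding laplace by (intro for_general_mono[OF m]) (simp add: of_nat_diff)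
    ultimately show "\<exists>\<delta>\<ge>1. satisfies_Laplace_equations N G (d - 1) \<delta>"
      by (intro exI[of _ "?M - m"]) simp
  next
    assume "\<exists>\<delta>\<ge>1. satisfies_Laplace_equations N G (d - 1) \<delta>"
    then obtain \<delta> where \<delta>: "\<delta> \<ge> 1" "for_general (\<lambda>x. int (?dim x) = int ?M - int \<delta>)"
      unfolding laplace by blast
    from \<delta>(2) show "for_general K"
    proof (rule for_general_mono)
      fix x assume "int (?dim x) = int ?M - int \<delta>"
      then have "?dim x < ?M" using \<delta>(1) by linarith
      then show "K x" using dim_less by blast
    qed
  qed
  then show ?thesis using 12 by blast
qed

end
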